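(* Let $(M,\omega)$ be a compact connected Kähler manifold without boundary, of complex dimension $n$. The constant weight metric $\langle G_1,G_2\rangle_{F;1}=\int_MG_1G_2\frac{\omega^n}{n!}$ on the space $\mathcal{C}$ of volume conformal factors has sectional curvature zero.
   Context: $\mathcal{C}=\{F\in C^\infty(M,\mathbb{R}): F>0,\ \int_MF\omega^n=\int_M\omega^n\}$, with tangent space $T_F\mathcal{C}=\{G\in C^\infty(M,\mathbb{R}):\int_MG\,\omega^n=0\}$. The Levi-Civita covariant derivative $D$ of a Riemannian metric on $\mathcal{C}$ is the unique covariant derivative of smooth vector fields along smooth curves in $\mathcal{C}$ that is additive, satisfies the Leibniz rule, is compatible with the metric and is torsion free ($D_tF_s=D_sF_t$ for smooth two-parameter families $F(s,t)$). The sectional curvature of the plane spanned by linearly independent $F_s,F_t$ is $\langle D_sD_tF_t-D_tD_sF_t,F_s\rangle_F\big/\big(\langle F_s,F_s\rangle_F\langle F_t,F_t\rangle_F-\langle F_s,F_t\rangle_F^2\big)$. *)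

theory Defs
  imports "HOL-Analysis.Analysis" "HOL-Combinatorics.Permutations"
begin

section \<open>Smooth and holomorphic maps between vector spaces\<close>

text \<open>The set \<open>S\<close> is always open below; in finite dimension, all iterated directional
  derivatives existing as Frechet derivatives is the usual notion of class \<open>C\<^sup>k\<close>.\<close>

primrec ck_on :: "nat \<Rightarrow> 'v::real_normed_vector set \<Rightarrow> ('v \<Rightarrow> 'w::real_normed_vector) \<Rightarrow> bool" where
  "ck_on 0 S f \<longleftrightarrow> continuous_on S f"
| "ck_on (Suc k) S f \<longleftrightarrow> (\<forall>x\<in>S. f differentiable (at x)) \<and>
     (\<forall>v. ck_on k S (\<lambda>x. frechet_derivative f (at x) v))"

definition smooth_on :: "'v::real_normed_vector set \<Rightarrow> ('v \<Rightarrow> 'w::real_normed_vector) \<Rightarrow> bool" where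
  "smooth_on S f \<longleftrightarrow> (\<forall>k. ck_on k S f)"

definition holomorphic_map_on :: "(complex^'n) set \<Rightarrow> (complex^'n \<Rightarrow> complex^'n) \<Rightarrow> bool" where
  "holomorphic_map_on S f \<longleftrightarrow>
     (\<forall>z\<in>S. \<exists>f'. (f has_derivative f') (at z) \<and> (\<forall>c v. f' (c *s v) = c *s f' v))"

section \<open>Complex manifolds\<close>

text \<open>The underlying space of the manifold is the whole Hausdorff type \<open>'a\<close>. Second
  countability is not required separately, since it follows from compactness. A chart is a
  coordinate domain with a coordinate map, whose values outside the domain are irrelevant.\<close>

type_synonym ('a, 'n) chart = "'a set \<times> ('a \<Rightarrow> complex^'n)"

definition chart_image :: "('a, 'n) chart \<Rightarrow> (complex^'n) set" where
  "chart_image c = snd c ` fst c"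

definition chart_inv :: "('a, 'n) chart \<Rightarrow> complex^'n \<Rightarrow> 'a" where
  "chart_inv c = inv_into (fst c) (snd c)"

definition complex_atlas :: "('a::t2_space, 'n::finite) chart set \<Rightarrow> bool" where
  "complex_atlas A \<longleftrightarrow>
     (\<Union>c\<in>A. fst c) = UNIV \<and>
     (\<forall>c\<in>A. open (fst c) \<and> open (chart_image c) \<and>
        homeomorphism (fst c) (chart_image c) (snd c) (chart_inv c)) \<and>
     (\<forall>c\<in>A. \<forall>c'\<in>A. holomorphic_map_on (snd c ` (fst c \<inter> fst c')) (snd c' \<circ> chart_inv c))"

definition smooth_fun :: "('a::t2_space, 'n::finite) chart set \<Rightarrow> ('a \<Rightarrow> real) \<Rightarrow> bool" where
  "smooth_fun A F \<longleftrightarrow> (\<forall>c\<in>A. smooth_on (chart_image c) (\<lambda>z. F (chart_inv c z)))"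

text \<open>Joint smoothness in the parameter and the point. On a compact manifold this is
  the same as smoothness of \<open>p \<mapsto> F p\<close> as a map into the Frechet space of smooth functions.\<close>

definition smooth_family ::
  "('a::t2_space, 'n::finite) chart set \<Rightarrow> 'p::euclidean_space set \<Rightarrow> ('p \<Rightarrow> 'a \<Rightarrow> real) \<Rightarrow> bool" where
  "smooth_family A P F \<longleftrightarrow>
     (\<forall>c\<in>A. smooth_on (P \<times> chart_image c) (\<lambda>(p, z). F p (chart_inv c z)))"

section \<open>Kaehler forms\<close>

text \<open>A two-form is given by its local representatives: \<open>\<omega> c z v w\<close> is the value at the point
  with coordinate \<open>z\<close> in chart \<open>c\<close> on the tangent vectors with coordinates \<open>v\<close>, \<open>w\<close>.\<close>

type_synonym ('a, 'n) two_form =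
  "('a, 'n) chart \<Rightarrow> complex^'n \<Rightarrow> complex^'n \<Rightarrow> complex^'n \<Rightarrow> real"

definition smooth_two_form ::
  "('a::t2_space, 'n::finite) chart set \<Rightarrow> ('a, 'n) two_form \<Rightarrow> bool" where
  "smooth_two_form A \<omega> \<longleftrightarrow>
     (\<forall>c\<in>A. \<forall>z\<in>chart_image c. bilinear (\<omega> c z) \<and> (\<forall>v. \<omega> c z v v = 0)) \<and>
     (\<forall>c\<in>A. \<forall>v w. smooth_on (chart_image c) (\<lambda>z. \<omega> c z v w)) \<and>
     (\<forall>c\<in>A. \<forall>c'\<in>A. \<forall>z\<in>snd c ` (fst c \<inter> fst c'). \<forall>v w.
        let \<tau> = snd c' \<circ> chart_inv c; \<tau>' = frechet_derivative \<tau> (at z)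
        in \<omega> c z v w = \<omega> c' (\<tau> z) (\<tau>' v) (\<tau>' w))"

definition closed_two_form ::
  "('a::t2_space, 'n::finite) chart set \<Rightarrow> ('a, 'n) two_form \<Rightarrow> bool" where
  "closed_two_form A \<omega> \<longleftrightarrow>
     (\<forall>c\<in>A. \<forall>z\<in>chart_image c. \<forall>u v w.
        frechet_derivative (\<lambda>y. \<omega> c y v w) (at z) u
      + frechet_derivative (\<lambda>y. \<omega> c y w u) (at z) v
      + frechet_derivative (\<lambda>y. \<omega> c y u v) (at z) w = 0)"

text \<open>Closed positive real (1,1)-forms; the associated Riemannian metric is
  \<open>g(v, w) = \<omega>(v, J w)\<close>, where \<open>J\<close> is multiplication by \<open>\<i>\<close>.\<close>

definition kaehler_form ::
  "('a::t2_space, 'n::finite) chart set \<Rightarrow> ('a, 'n) two_form \<Rightarrow> bool" where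
  "kaehler_form A \<omega> \<longleftrightarrow> smooth_two_form A \<omega> \<and> closed_two_form A \<omega> \<and>
     (\<forall>c\<in>A. \<forall>z\<in>chart_image c.
        (\<forall>v w. \<omega> c z (\<i> *s v) (\<i> *s w) = \<omega> c z v w) \<and>
        (\<forall>v. v \<noteq> 0 \<longrightarrow> \<omega> c z v (\<i> *s v) > 0))"

definition compact_connected_kaehler ::
  "('a::t2_space, 'n::finite) chart set \<Rightarrow> ('a, 'n) two_form \<Rightarrow> bool" where
  "compact_connected_kaehler A \<omega> \<longleftrightarrow>
     compact (UNIV :: 'a set) \<and> connected (UNIV :: 'a set) \<and> complex_atlas A \<and> kaehler_form A \<omega>"

section \<open>Integration against the top power of the form\<close>

text \<open>The \<open>n\<close>-fold wedge power of an alternating bilinear form, evaluated on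
  \<open>v 0, \<dots>, v (2n - 1)\<close>. The normalisation is the one in which
  \<open>dx \<and> dy\<close> evaluates to 1 on the standard frame, so \<open>(\<Sum>j. dx\<^sub>j \<and> dy\<^sub>j)\<^sup>n\<close> is \<open>n!\<close> times
  Euclidean volume.\<close>

definition wedge_power :: "nat \<Rightarrow> ('v \<Rightarrow> 'v \<Rightarrow> real) \<Rightarrow> (nat \<Rightarrow> 'v) \<Rightarrow> real" where
  "wedge_power n \<alpha> v =
     (\<Sum>\<sigma> | \<sigma> permutes {..<2*n}.
        of_int (sign \<sigma>) * (\<Prod>j<n. \<alpha> (v (\<sigma> (2*j))) (v (\<sigma> (2*j+1))))) / 2^n"

text \<open>The positively oriented real frame \<open>e\<^sub>1, \<i> e\<^sub>1, \<dots>, e\<^sub>n, \<i> e\<^sub>n\<close>. The order in which the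
  coordinates are enumerated is immaterial: it changes the frame by an even permutation.\<close>

definition complex_frame :: "nat \<Rightarrow> complex^'n::finite" where
  "complex_frame k =
     (let b = (SOME b :: nat \<Rightarrow> 'n. bij_betw b {..<CARD('n)} UNIV)
      in axis (b (k div 2)) (if even k then 1 else \<i>))"

definition partition_of_unity ::
  "('a::t2_space, 'n::finite) chart set \<Rightarrow> ('a, 'n) chart set \<Rightarrow> (('a, 'n) chart \<Rightarrow> 'a \<Rightarrow> real) \<Rightarrow> bool"
where
  "partition_of_unity A C \<rho> \<longleftrightarrow> finite C \<and> C \<subseteq> A \<and>
     (\<forall>c\<in>C. continuous_on UNIV (\<rho> c) \<and> (\<forall>x. 0 \<le> \<rho> c x) \<and> closure {x. \<rho> c x \<noteq> 0} \<subseteq> fst c) \<and>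
     (\<forall>x. (\<Sum>c\<in>C. \<rho> c x) = 1)"

text \<open>\<open>\<integral>\<^sub>M F \<omega>\<^sup>n\<close>, by the usual partition of unity formula, whose value does not depend on the
  partition. Continuity of the partition functions suffices for integration.\<close>

definition top_integral ::
  "('a::t2_space, 'n::finite) chart set \<Rightarrow> ('a, 'n) two_form \<Rightarrow> ('a \<Rightarrow> real) \<Rightarrow> real" where
  "top_integral A \<omega> F =
     (let (C, \<rho>) = (SOME (C, \<rho>). partition_of_unity A C \<rho>)
      in \<Sum>c\<in>C. LINT z:chart_image c|lborel.
           \<rho> c (chart_inv c z) * F (chart_inv c z) * wedge_power CARD('n) (\<omega> c z) complex_frame)"

section \<open>The space of volume conformal factors\<close>

definition conformal_factors ::
  "('a::t2_space, 'n::finite) chart set \<Rightarrow> ('a, 'n) two_form \<Rightarrow> ('a \<Rightarrow> real) set" where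
  "conformal_factors A \<omega> =
     {F. smooth_fun A F \<and> (\<forall>x. F x > 0) \<and> top_integral A \<omega> F = top_integral A \<omega> (\<lambda>_. 1)}"

definition tangent_vectors ::
  "('a::t2_space, 'n::finite) chart set \<Rightarrow> ('a, 'n) two_form \<Rightarrow> ('a \<Rightarrow> real) set" where
  "tangent_vectors A \<omega> = {G. smooth_fun A G \<and> top_integral A \<omega> G = 0}"

text \<open>The first argument of a metric is the base point.\<close>

type_synonym 'a metric_tensor = "('a \<Rightarrow> real) \<Rightarrow> ('a \<Rightarrow> real) \<Rightarrow> ('a \<Rightarrow> real) \<Rightarrow> real"

definition constant_weight_metric ::
  "('a::t2_space, 'n::finite) chart set \<Rightarrow> ('a, 'n) two_form \<Rightarrow> 'a metric_tensor" where
  "constant_weight_metric A \<omega> F G\<^sub>1 G\<^sub>2 = top_integral A \<omega> (\<lambda>x. G\<^sub>1 x * G\<^sub>2 x) / fact CARD('n)"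

definition open_interval :: "real set \<Rightarrow> bool" where
  "open_interval I \<longleftrightarrow> open I \<and> is_interval I"

definition smooth_curve ::
  "('a::t2_space, 'n::finite) chart set \<Rightarrow> ('a, 'n) two_form \<Rightarrow> real set \<Rightarrow> (real \<Rightarrow> 'a \<Rightarrow> real) \<Rightarrow> bool"
where
  "smooth_curve A \<omega> I F \<longleftrightarrow>
     open_interval I \<and> smooth_family A I F \<and> (\<forall>t\<in>I. F t \<in> conformal_factors A \<omega>)"

text \<open>All tangent spaces coincide, so the curve along which the field is taken does not
  enter.\<close>

definition smooth_field ::
  "('a::t2_space, 'n::finite) chart set \<Rightarrow> ('a, 'n) two_form \<Rightarrow> real set \<Rightarrow> (real \<Rightarrow> 'a \<Rightarrow> real) \<Rightarrow> bool"
where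
  "smooth_field A \<omega> I G \<longleftrightarrow> smooth_family A I G \<and> (\<forall>t\<in>I. G t \<in> tangent_vectors A \<omega>)"

definition smooth_two_parameter ::
  "('a::t2_space, 'n::finite) chart set \<Rightarrow> ('a, 'n) two_form \<Rightarrow> real set \<Rightarrow> real set \<Rightarrow>
   (real \<Rightarrow> real \<Rightarrow> 'a \<Rightarrow> real) \<Rightarrow> bool"
where
  "smooth_two_parameter A \<omega> I J F \<longleftrightarrow> open_interval I \<and> open_interval J \<and>
     smooth_family A (I \<times> J) (\<lambda>(s, t). F s t) \<and>
     (\<forall>s\<in>I. \<forall>t\<in>J. F s t \<in> conformal_factors A \<omega>)"

definition partial_s :: "(real \<Rightarrow> real \<Rightarrow> 'a \<Rightarrow> real) \<Rightarrow> real \<Rightarrow> real \<Rightarrow> 'a \<Rightarrow> real" where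
  "partial_s F s t x = deriv (\<lambda>s'. F s' t x) s"

definition partial_t :: "(real \<Rightarrow> real \<Rightarrow> 'a \<Rightarrow> real) \<Rightarrow> real \<Rightarrow> real \<Rightarrow> 'a \<Rightarrow> real" where
  "partial_t F s t x = deriv (\<lambda>t'. F s t' x) t"

section \<open>Levi-Civita covariant derivative and sectional curvature\<close>

text \<open>\<open>D I F G\<close> is the covariant derivative of the field \<open>G\<close> along the curve \<open>F\<close>, both
  parametrised by the interval \<open>I\<close>.\<close>

type_synonym 'a covariant_derivative =
  "real set \<Rightarrow> (real \<Rightarrow> 'a \<Rightarrow> real) \<Rightarrow> (real \<Rightarrow> 'a \<Rightarrow> real) \<Rightarrow> (real \<Rightarrow> 'a \<Rightarrow> real)"

definition cov_s :: "'a covariant_derivative \<Rightarrow> real set \<Rightarrow> (real \<Rightarrow> real \<Rightarrow> 'a \<Rightarrow> real) \<Rightarrow>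
    (real \<Rightarrow> real \<Rightarrow> 'a \<Rightarrow> real) \<Rightarrow> real \<Rightarrow> real \<Rightarrow> 'a \<Rightarrow> real" where
  "cov_s D I F H s t = D I (\<lambda>s'. F s' t) (\<lambda>s'. H s' t) s"

definition cov_t :: "'a covariant_derivative \<Rightarrow> real set \<Rightarrow> (real \<Rightarrow> real \<Rightarrow> 'a \<Rightarrow> real) \<Rightarrow>
    (real \<Rightarrow> real \<Rightarrow> 'a \<Rightarrow> real) \<Rightarrow> real \<Rightarrow> real \<Rightarrow> 'a \<Rightarrow> real" where
  "cov_t D J F H s t = D J (F s) (H s) t"

text \<open>Curves and fields on \<open>I\<close> are encoded by functions on all of \<open>real\<close>; the second
  clause says that \<open>D\<close> ignores their values outside \<open>I\<close>.\<close>

definition covariant_derivative ::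
  "('a::t2_space, 'n::finite) chart set \<Rightarrow> ('a, 'n) two_form \<Rightarrow> 'a covariant_derivative \<Rightarrow> bool" where
  "covariant_derivative A \<omega> D \<longleftrightarrow>
     (\<forall>I F G. smooth_curve A \<omega> I F \<and> smooth_field A \<omega> I G \<longrightarrow> smooth_field A \<omega> I (D I F G)) \<and>
     (\<forall>I F F' G G'. smooth_curve A \<omega> I F \<and> smooth_field A \<omega> I G \<and>
        (\<forall>t\<in>I. F' t = F t \<and> G' t = G t) \<longrightarrow> (\<forall>t\<in>I. D I F' G' t = D I F G t)) \<and>
     (\<forall>I F G H. smooth_curve A \<omega> I F \<and> smooth_field A \<omega> I G \<and> smooth_field A \<omega> I H \<longrightarrow>
        (\<forall>t\<in>I. \<forall>x. D I F (\<lambda>t x. G t x + H t x) t x = D I F G t x + D I F H t x)) \<and>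
     (\<forall>I F G f. smooth_curve A \<omega> I F \<and> smooth_field A \<omega> I G \<and> smooth_on I f \<longrightarrow>
        (\<forall>t\<in>I. \<forall>x. D I F (\<lambda>t x. f t * G t x) t x = deriv f t * G t x + f t * D I F G t x))"

definition metric_compatible ::
  "('a::t2_space, 'n::finite) chart set \<Rightarrow> ('a, 'n) two_form \<Rightarrow> 'a metric_tensor \<Rightarrow>
   'a covariant_derivative \<Rightarrow> bool" where
  "metric_compatible A \<omega> g D \<longleftrightarrow>
     (\<forall>I F G H. smooth_curve A \<omega> I F \<and> smooth_field A \<omega> I G \<and> smooth_field A \<omega> I H \<longrightarrow>
        (\<forall>t\<in>I. ((\<lambda>t. g (F t) (G t) (H t)) has_real_derivative
                  g (F t) (D I F G t) (H t) + g (F t) (G t) (D I F H t)) (at t)))"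

definition torsion_free ::
  "('a::t2_space, 'n::finite) chart set \<Rightarrow> ('a, 'n) two_form \<Rightarrow> 'a covariant_derivative \<Rightarrow> bool" where
  "torsion_free A \<omega> D \<longleftrightarrow>
     (\<forall>I J F. smooth_two_parameter A \<omega> I J F \<longrightarrow>
        (\<forall>s\<in>I. \<forall>t\<in>J. cov_t D J F (partial_s F) s t = cov_s D I F (partial_t F) s t))"

definition levi_civita ::
  "('a::t2_space, 'n::finite) chart set \<Rightarrow> ('a, 'n) two_form \<Rightarrow> 'a metric_tensor \<Rightarrow>
   'a covariant_derivative \<Rightarrow> bool" where
  "levi_civita A \<omega> g D \<longleftrightarrow>
     covariant_derivative A \<omega> D \<and> metric_compatible A \<omega> g D \<and> torsion_free A \<omega> D"

definition lin_indep_pair :: "('a \<Rightarrow> real) \<Rightarrow> ('a \<Rightarrow> real) \<Rightarrow> bool" where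
  "lin_indep_pair G H \<longleftrightarrow> (\<forall>a b. (\<forall>x. a * G x + b * H x = 0) \<longrightarrow> a = 0 \<and> b = 0)"

definition sectional_curvature ::
  "'a metric_tensor \<Rightarrow> 'a covariant_derivative \<Rightarrow> real set \<Rightarrow> real set \<Rightarrow>
   (real \<Rightarrow> real \<Rightarrow> 'a \<Rightarrow> real) \<Rightarrow> real \<Rightarrow> real \<Rightarrow> real" where
  "sectional_curvature g D I J F s t =
     (let F\<^sub>s = partial_s F; F\<^sub>t = partial_t F;
          R = (\<lambda>x. cov_s D I F (cov_t D J F F\<^sub>t) s t x - cov_t D J F (cov_s D I F F\<^sub>t) s t x)
      in g (F s t) R (F\<^sub>s s t) /
         (g (F s t) (F\<^sub>s s t) (F\<^sub>s s t) * g (F s t) (F\<^sub>t s t) (F\<^sub>t s t)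
            - (g (F s t) (F\<^sub>s s t) (F\<^sub>t s t))\<^sup>2))"

end

theory Submission
  imports Defs
begin

text \<open>The constant weight metric does not involve the base point, and the space \<open>\<C>\<close> of conformal factors
is an open convex piece of an affine hyperplane: a flat space. Accordingly its Levi-Civita derivative
is the ordinary pointwise derivative \<open>\<partial>G/\<partial>t\<close> of a field along a curve, covariant derivatives in two
parameters commute because mixed partial derivatives do, and the curvature vanishes.

Turning this into a proof takes three steps.

Analysis of the integral. The functional \<open>F \<mapsto> \<integral> F \<omega>\<^sup>n\<close> is linear and strictly positive on continuous
functions. Strictness needs \<open>\<omega>\<^sup>n\<close> to be positive on the frame \<open>e\<^sub>1, \<i> e\<^sub>1, \<dots>, e\<^sub>n, \<i> e\<^sub>n\<close>
(\<open>wedge_power_pos\<close>), which is Gaussian elimination with the pivots \<open>v, \<i> v\<close>; each pivot contributes the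
positive factor \<open>\<omega>(v, \<i> v)\<close>. Together with compactness, positivity also gives differentiation
under the integral sign (\<open>top_integral_has_deriv\<close>), because difference quotients of a smooth family
converge uniformly. Hence the pointwise derivative of a field stays tangent to \<open>\<C>\<close>, and it is a
Levi-Civita derivative (\<open>levi_civita_pointwise_deriv\<close>).

Uniqueness. Let \<open>D\<close> be any Levi-Civita derivative. Metric compatibility alone shows that
\<open>D G - \<partial>G/\<partial>t\<close> at the parameter \<open>t\<close> depends on \<open>G\<close> only through the vector \<open>G t\<close>, and that the resulting
operator on the tangent space is skew (\<open>D_eq\<close>, \<open>christoffel_skew\<close>). This operator could a priori depend on the
whole curve and on its interval of definition. Absence of torsion relates the operators of the two
coordinate curves of a two-parameter family (\<open>christoffel_symmetric\<close>). Given a curve and two tangent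
vectors at one of its points, there are three two-parameter families that pairwise join the curve
and two auxiliary curves with these velocities. A trilinear form that is symmetric in the first two
arguments and skew in the last two is zero, and the same argument, run with these three families,
shows that the operator is zero (\<open>christoffel_eq_0\<close>).

Curvature. By uniqueness every Levi-Civita derivative is the pointwise one, so the
numerator of the sectional curvature is the integral of \<open>(\<partial>\<^sub>s\<partial>\<^sub>t - \<partial>\<^sub>t\<partial>\<^sub>s) F\<^sub>t = 0\<close> against \<open>F\<^sub>s\<close>
(\<open>sectional_curvature_eq_0\<close>).\<close>

section \<open>Calculus of smooth maps\<close>

lemma frechet_derivative_eqI: "(f has_derivative f') (at x) \<Longrightarrow> frechet_derivative f (at x) = f'"
  using frechet_derivative_at by metis

text \<open>On an open set the derivatives of \<open>f\<close> see only the values of \<open>f\<close> on that set; this is what allows a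
derivative to be replaced by its explicit formula in the inductions below.\<close>

lemma ck_on_cong:
  assumes "open S" "\<And>x. x \<in> S \<Longrightarrow> f x = g x" "ck_on k S f"
  shows "ck_on k S g"
  using assms(2,3)
proof (induction k arbitrary: f g)
  case 0
  then show ?case using continuous_on_cong by (metis ck_on.simps(1))
next
  case (Suc k)
  have g: "(g has_derivative frechet_derivative f (at x)) (at x)" if "x \<in> S" for x
    using Suc.prems that \<open>open S\<close>
    by (metis ck_on.simps(2) frechet_derivative_works has_derivative_transform_within_open)
  then have "g differentiable at x" if "x \<in> S" for x
    using that by (auto simp: differentiable_def)
  moreover have "ck_on k S (\<lambda>x. frechet_derivative g (at x) v)" for v
    by (rule Suc.IH[of "\<lambda>x. frechet_derivative f (at x) v"])
       (use Suc.prems g[THEN frechet_derivative_eqI] in auto)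
  ultimately show ?case by simp
qed

lemma ck_on_SucD: "ck_on (Suc k) S f \<Longrightarrow> ck_on k S f"
proof (induction k arbitrary: f)
  case 0
  then show ?case
    by (auto intro!: continuous_at_imp_continuous_on differentiable_imp_continuous_within)
next
  case (Suc k)
  then show ?case by (metis ck_on.simps(2))
qed

lemma ck_on_const: "ck_on k S (\<lambda>_. c)"
  by (induction k arbitrary: c) auto

lemma ck_on_bounded_linear: "bounded_linear L \<Longrightarrow> ck_on k S L"
proof (cases k)
  case (Suc m)
  assume "bounded_linear L"
  then have d: "(L has_derivative L) (at x)" for x
    by (rule bounded_linear_imp_has_derivative)
  then show ?thesis
    using Suc by (auto simp: differentiable_def ck_on_const d[THEN frechet_derivative_eqI])
qed (simp add: linear_continuous_on)

lemma ck_on_add: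
  assumes "open S" "ck_on k S f" "ck_on k S g"
  shows "ck_on k S (\<lambda>x. f x + g x)"
  using assms(2,3)
proof (induction k arbitrary: f g)
  case 0
  then show ?case by (auto intro: continuous_on_add)
next
  case (Suc k)
  have d: "((\<lambda>x. f x + g x) has_derivative
      (\<lambda>v. frechet_derivative f (at x) v + frechet_derivative g (at x) v)) (at x)" if "x \<in> S" for x
    using Suc.prems that by (intro has_derivative_add) (auto simp: frechet_derivative_works[symmetric])
  have "ck_on k S (\<lambda>x. frechet_derivative (\<lambda>x. f x + g x) (at x) v)" for v
    by (rule ck_on_cong[OF \<open>open S\<close> _ Suc.IH[of "\<lambda>x. frechet_derivative f (at x) v" "\<lambda>x. frechet_derivative g (at x) v"]])
       (use Suc.prems d[THEN frechet_derivative_eqI] in auto)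
  then show ?case using d by (auto simp: differentiable_def)
qed

lemma ck_on_mult:
  fixes f g :: "'v::real_normed_vector \<Rightarrow> 'w::real_normed_algebra"
  assumes "open S" "ck_on k S f" "ck_on k S g"
  shows "ck_on k S (\<lambda>x. f x * g x)"
  using assms(2,3)
proof (induction k arbitrary: f g)
  case 0
  then show ?case by (auto intro: continuous_on_mult)
next
  case (Suc k)
  have d: "((\<lambda>x. f x * g x) has_derivative
      (\<lambda>v. f x * frechet_derivative g (at x) v + frechet_derivative f (at x) v * g x)) (at x)" if "x \<in> S" for x
    using Suc.prems that by (intro has_derivative_mult) (auto simp: frechet_derivative_works[symmetric])
  have e: "ck_on k S (\<lambda>x. f x * frechet_derivative g (at x) v + frechet_derivative f (at x) v * g x)" for v
    using Suc.prems by (intro ck_on_add[OF \<open>open S\<close>] Suc.IH) (auto intro: ck_on_SucD)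
  have "ck_on k S (\<lambda>x. frechet_derivative (\<lambda>x. f x * g x) (at x) v)" for v
    by (rule ck_on_cong[OF \<open>open S\<close>, rotated, OF e[of v]]) (use d[THEN frechet_derivative_eqI] in auto)
  then show ?case using d by (auto simp: differentiable_def)
qed

text \<open>The derivative \<open>- f\<^bsup>-1\<^esup> f' f\<^bsup>-1\<^esup>\<close> is a product of maps that are \<open>C\<^sup>k\<close> by the induction hypothesis.\<close>

lemma ck_on_inverse:
  fixes f :: "'v::real_normed_vector \<Rightarrow> 'w::real_normed_field"
  assumes "open S" "\<And>x. x \<in> S \<Longrightarrow> f x \<noteq> 0" "ck_on k S f"
  shows "ck_on k S (\<lambda>x. inverse (f x))"
  using assms(3)
proof (induction k)
  case 0
  then show ?case using assms(2) by (auto intro: continuous_on_inverse)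
next
  case (Suc k)
  have d: "((\<lambda>x. inverse (f x)) has_derivative
      (\<lambda>v. - (inverse (f x) * frechet_derivative f (at x) v * inverse (f x)))) (at x)" if "x \<in> S" for x
    using Suc.prems that assms(2)
    by (intro Deriv.has_derivative_inverse) (auto simp: frechet_derivative_works[symmetric])
  have e: "ck_on k S (\<lambda>x. (-1) * (inverse (f x) * frechet_derivative f (at x) v * inverse (f x)))" for v
    using Suc.prems by (intro ck_on_mult[OF \<open>open S\<close>] ck_on_const Suc.IH[OF ck_on_SucD]) auto
  have "ck_on k S (\<lambda>x. frechet_derivative (\<lambda>x. inverse (f x)) (at x) v)" for v
    by (rule ck_on_cong[OF \<open>open S\<close>, rotated, OF e[of v]]) (use d[THEN frechet_derivative_eqI] in auto)
  then show ?case using d by (auto simp: differentiable_def)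
qed

text \<open>The differential of an affine map is constant, so differentiating the composite only ever
differentiates \<open>f\<close>, in the directions \<open>L v\<close>. Restricting a family to a slice, and extending a function
of the point or of the parameter to a family, are compositions of this kind.\<close>

lemma ck_on_compose_affine:
  assumes "open T" "bounded_linear L" "\<And>x. x \<in> T \<Longrightarrow> L x + c \<in> S" "ck_on k S f"
  shows "ck_on k T (\<lambda>x. f (L x + c))"
  using assms(4)
proof (induction k arbitrary: f)
  case 0
  have c: "continuous_on T (\<lambda>x. L x + c)"
    using assms(2) by (intro continuous_intros linear_continuous_on)
  show ?case
    using continuous_on_compose2[OF _ c, of S f] 0 assms(3) by auto
next
  case (Suc k)
  have d: "((\<lambda>x. f (L x + c)) has_derivative (\<lambda>v. frechet_derivative f (at (L x + c)) (L v))) (at x)"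
    if "x \<in> T" for x
  proof -
    have 1: "((\<lambda>x. L x + c) has_derivative L) (at x)"
      using bounded_linear_imp_has_derivative[OF assms(2)] by (rule has_derivative_add_const)
    have 2: "(f has_derivative frechet_derivative f (at (L x + c))) (at (L x + c))"
      using Suc.prems assms(3)[OF that] by (simp add: frechet_derivative_works[symmetric])
    show ?thesis by (rule has_derivative_compose[OF 1 2])
  qed
  have e: "ck_on k T (\<lambda>x. frechet_derivative f (at (L x + c)) (L v))" for v
    using Suc.IH[of "\<lambda>y. frechet_derivative f (at y) (L v)"] Suc.prems by simp
  have "ck_on k T (\<lambda>x. frechet_derivative (\<lambda>x. f (L x + c)) (at x) v)" for v
    by (rule ck_on_cong[OF \<open>open T\<close>, rotated, OF e[of v]]) (use d[THEN frechet_derivative_eqI] in auto)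
  moreover have "(\<lambda>x. f (L x + c)) differentiable at x" if "x \<in> T" for x
    by (rule differentiableI[OF d[OF that]])
  ultimately show ?case by simp
qed

lemma smooth_on_cong:
  "open S \<Longrightarrow> (\<And>x. x \<in> S \<Longrightarrow> f x = g x) \<Longrightarrow> smooth_on S f \<Longrightarrow> smooth_on S g"
  unfolding smooth_on_def by (intro allI, rule ck_on_cong[where f = f]) auto

lemma smooth_on_const: "smooth_on S (\<lambda>_. c)"
  by (simp add: smooth_on_def ck_on_const)

lemma smooth_on_bounded_linear: "bounded_linear L \<Longrightarrow> smooth_on S L"
  by (simp add: smooth_on_def ck_on_bounded_linear)

lemma smooth_on_add: "open S \<Longrightarrow> smooth_on S f \<Longrightarrow> smooth_on S g \<Longrightarrow> smooth_on S (\<lambda>x. f x + g x)"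
  by (simp add: smooth_on_def ck_on_add)

lemma smooth_on_mult:
  fixes f g :: "'v::real_normed_vector \<Rightarrow> 'w::real_normed_algebra"
  shows "open S \<Longrightarrow> smooth_on S f \<Longrightarrow> smooth_on S g \<Longrightarrow> smooth_on S (\<lambda>x. f x * g x)"
  by (simp add: smooth_on_def ck_on_mult)

lemma smooth_on_inverse:
  fixes f :: "'v::real_normed_vector \<Rightarrow> 'w::real_normed_field"
  shows "open S \<Longrightarrow> (\<And>x. x \<in> S \<Longrightarrow> f x \<noteq> 0) \<Longrightarrow> smooth_on S f \<Longrightarrow> smooth_on S (\<lambda>x. inverse (f x))"
  by (simp add: smooth_on_def ck_on_inverse)

lemma smooth_on_compose_affine:
  "open T \<Longrightarrow> bounded_linear L \<Longrightarrow> (\<And>x. x \<in> T \<Longrightarrow> L x + c \<in> S) \<Longrightarrow> smooth_on S f \<Longrightarrow>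
    smooth_on T (\<lambda>x. f (L x + c))"
  unfolding smooth_on_def by (intro allI, rule ck_on_compose_affine[where S = S]) auto

lemma smooth_on_imp_continuous_on: "smooth_on S f \<Longrightarrow> continuous_on S f"
  using ck_on.simps(1) by (metis smooth_on_def)

lemma smooth_on_has_derivative:
  "smooth_on S f \<Longrightarrow> x \<in> S \<Longrightarrow> (f has_derivative frechet_derivative f (at x)) (at x)"
  unfolding smooth_on_def by (metis ck_on.simps(2) frechet_derivative_works)

lemma smooth_on_directional_derivative:
  "smooth_on S f \<Longrightarrow> smooth_on S (\<lambda>x. frechet_derivative f (at x) v)"
  unfolding smooth_on_def by (metis ck_on.simps(2))

lemma smooth_on_has_deriv:
  fixes f :: "real \<Rightarrow> real"
  assumes "smooth_on S f" "x \<in> S"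
  shows "(f has_real_derivative deriv f x) (at x)"
  using assms by (metis DERIV_deriv_iff_real_differentiable differentiable_def smooth_on_has_derivative)

lemma has_real_derivative_at_frechet:
  fixes f :: "real \<Rightarrow> real"
  assumes "(f has_derivative f') (at x)"
  shows "(f has_real_derivative f' 1) (at x)"
proof -
  have "f' h = f' 1 * h" for h
    using linear_scale[OF has_derivative_linear[OF assms], of h 1] by simp
  then have "f' = (*) (f' 1)" by (rule ext)
  then show ?thesis using assms by (simp add: has_field_derivative_def)
qed

section \<open>Equality of mixed partial derivatives\<close>

text \<open>The mean value theorem, used once in each variable, expresses the second difference over a
rectangle by a mixed partial derivative at an interior point. The rectangle does not distinguish the
variables, so the same difference is also given by the mixed derivative in the other order.\<close>

lemma mixed_difference_mean_value:
  fixes f fs fst' :: "real \<Rightarrow> real \<Rightarrow> real"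
  assumes "h > 0" "k > 0"
    and "\<And>x y. s \<le> x \<Longrightarrow> x \<le> s + h \<Longrightarrow> t \<le> y \<Longrightarrow> y \<le> t + k \<Longrightarrow> ((\<lambda>x. f x y) has_real_derivative fs x y) (at x)"
    and "\<And>x y. s \<le> x \<Longrightarrow> x \<le> s + h \<Longrightarrow> t \<le> y \<Longrightarrow> y \<le> t + k \<Longrightarrow> ((\<lambda>y. fs x y) has_real_derivative fst' x y) (at y)"
  shows "\<exists>x y. s < x \<and> x < s + h \<and> t < y \<and> y < t + k \<and>
     f (s + h) (t + k) - f (s + h) t - f s (t + k) + f s t = h * k * fst' x y"
proof -
  have "\<exists>x. x > s \<and> x < s + h \<and>
    (f (s + h) (t + k) - f (s + h) t) - (f s (t + k) - f s t) = (s + h - s) * (fs x (t + k) - fs x t)"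
    using assms by (intro MVT2[of s "s + h" "\<lambda>x. f x (t + k) - f x t"]) (auto intro!: DERIV_diff)
  then obtain x where x: "s < x" "x < s + h"
    "(f (s + h) (t + k) - f (s + h) t) - (f s (t + k) - f s t) = h * (fs x (t + k) - fs x t)" by auto
  have "\<exists>y. y > t \<and> y < t + k \<and> fs x (t + k) - fs x t = (t + k - t) * fst' x y"
    using assms x by (intro MVT2) auto
  then obtain y where y: "t < y" "y < t + k" "fs x (t + k) - fs x t = k * fst' x y" by auto
  show ?thesis
    using x y by (intro exI[of _ x] exI[of _ y]) (simp add: algebra_simps)
qed

text \<open>Both mixed partials occur as \<open>(second difference) / h\<^sup>2\<close> at points of the square with
corner \<open>(s, t)\<close> and side \<open>h\<close>; by continuity they agree in the limit. Only small \<open>h\<close> matters,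
so the argument is run with one \<open>h\<close> that would separate the two values.\<close>

lemma mixed_partials_eq:
  fixes f :: "real \<Rightarrow> real \<Rightarrow> real"
  assumes "open (I \<times> J)" "(s, t) \<in> I \<times> J"
    and fs: "\<And>x y. (x, y) \<in> I \<times> J \<Longrightarrow> ((\<lambda>x. f x y) has_real_derivative fs x y) (at x)"
    and ft: "\<And>x y. (x, y) \<in> I \<times> J \<Longrightarrow> ((\<lambda>y. f x y) has_real_derivative ft x y) (at y)"
    and fst: "\<And>x y. (x, y) \<in> I \<times> J \<Longrightarrow> ((\<lambda>y. fs x y) has_real_derivative f12 x y) (at y)"
    and fts: "\<And>x y. (x, y) \<in> I \<times> J \<Longrightarrow> ((\<lambda>x. ft x y) has_real_derivative f21 x y) (at x)"
    and c12: "continuous_on (I \<times> J) (\<lambda>(x, y). f12 x y)"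
    and c21: "continuous_on (I \<times> J) (\<lambda>(x, y). f21 x y)"
  shows "f12 s t = f21 s t"
proof (rule ccontr)
  assume "f12 s t \<noteq> f21 s t"
  define e where "e = \<bar>f12 s t - f21 s t\<bar> / 2"
  have e: "e > 0" using \<open>f12 s t \<noteq> f21 s t\<close> by (simp add: e_def)
  obtain r0 where r0: "r0 > 0" "ball (s, t) r0 \<subseteq> I \<times> J" using assms openE by blast
  have "\<exists>d>0. \<forall>p\<in>I \<times> J. dist p (s, t) < d \<longrightarrow> dist ((\<lambda>(x, y). g x y) p) (g s t) < e"
    if "continuous_on (I \<times> J) (\<lambda>(x, y). g x y)" for g :: "real \<Rightarrow> real \<Rightarrow> real"
    using that \<open>e > 0\<close> assms(2) unfolding continuous_on_iff by fastforce
  then obtain r1 r2 where r12: "r1 > 0" "r2 > 0"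
    "\<And>p. p \<in> I \<times> J \<Longrightarrow> dist p (s, t) < r1 \<Longrightarrow> dist ((\<lambda>(x, y). f12 x y) p) (f12 s t) < e"
    "\<And>p. p \<in> I \<times> J \<Longrightarrow> dist p (s, t) < r2 \<Longrightarrow> dist ((\<lambda>(x, y). f21 x y) p) (f21 s t) < e"
    using c12 c21 by metis
  define r where "r = Min {r0, r1, r2}"
  define h where "h = r / 3"
  have r: "r > 0" "r \<le> r0" "r \<le> r1" "r \<le> r2" and h: "h > 0" using r0 r12 by (auto simp: r_def h_def)
  have near: "dist (x, y) (s, t) < r" if "s \<le> x" "x \<le> s + h" "t \<le> y" "y \<le> t + h" for x y
  proof -
    have "dist (x, y) (s, t) \<le> dist x s + dist y t"
      unfolding dist_Pair_Pair by (rule sqrt_sum_squares_le_sum) auto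
    then show ?thesis using that h r by (auto simp: dist_real_def h_def)
  qed
  then have box: "(x, y) \<in> I \<times> J" if "s \<le> x" "x \<le> s + h" "t \<le> y" "y \<le> t + h" for x y
    using r r0(2) that by (smt (verit) dist_commute mem_ball subsetD)
  obtain x y where 1: "s < x" "x < s + h" "t < y" "y < t + h"
    "f (s + h) (t + h) - f (s + h) t - f s (t + h) + f s t = h * h * f12 x y"
    using mixed_difference_mean_value[of h h s t f fs f12] h box fs fst by blast
  obtain y' x' where 2: "t < y'" "y' < t + h" "s < x'" "x' < s + h"
    "f (s + h) (t + h) - f s (t + h) - f (s + h) t + f s t = h * h * f21 x' y'"
    using mixed_difference_mean_value[of h h t s "\<lambda>y x. f x y" "\<lambda>y x. ft x y" "\<lambda>y x. f21 x y"] h box ft fts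
    by blast
  have "h * h * f12 x y = h * h * f21 x' y'" using 1(5) 2(5) by linarith
  then have "f12 x y = f21 x' y'" using h by simp
  moreover have "\<bar>f12 x y - f12 s t\<bar> < e" "\<bar>f21 x' y' - f21 s t\<bar> < e"
    using r12(3)[of "(x, y)"] r12(4)[of "(x', y')"] near[of x y] near[of x' y'] box[of x y] box[of x' y'] 1 2 r
    by (auto simp: dist_real_def)
  moreover have "\<bar>f12 s t - f21 s t\<bar> = 2 * e" by (simp add: e_def)
  ultimately show False by linarith
qed

section \<open>Positivity of the top power of a positive (1,1)-form\<close>

text \<open>For an alternating matrix \<open>a\<close> this is \<open>2\<^sup>n n!\<close> times the Pfaffian of \<open>a\<close>.\<close>

definition pairing_sum :: "nat \<Rightarrow> (nat \<Rightarrow> nat \<Rightarrow> real) \<Rightarrow> real" where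
  "pairing_sum n a =
     (\<Sum>\<sigma> | \<sigma> permutes {..<2*n}. of_int (sign \<sigma>) * (\<Prod>j<n. a (\<sigma> (2*j)) (\<sigma> (2*j+1))))"

lemma wedge_power_pairing_sum: "wedge_power n \<alpha> v = pairing_sum n (\<lambda>i j. \<alpha> (v i) (v j)) / 2^n"
  by (simp add: wedge_power_def pairing_sum_def)

text \<open>Composing the summation permutation with the transposition changes its sign.\<close>

lemma pairing_sum_transpose:
  assumes "p < 2*n" "q < 2*n" "p \<noteq> q"
  shows "pairing_sum n (\<lambda>i j. a (Transposition.transpose p q i) (Transposition.transpose p q j)) = - pairing_sum n a"
proof -
  have \<tau>: "Transposition.transpose p q permutes {..<2*n}" using assms by (intro permutes_swap_id) auto
  have "pairing_sum n a = (\<Sum>\<sigma> | \<sigma> permutes {..<2*n}. of_int (sign (Transposition.transpose p q \<circ> \<sigma>)) *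
      (\<Prod>j<n. a ((Transposition.transpose p q \<circ> \<sigma>) (2*j)) ((Transposition.transpose p q \<circ> \<sigma>) (2*j+1))))"
    unfolding pairing_sum_def by (rule setum_permutations_compose_left[OF \<tau>])
  also have "\<dots> = (\<Sum>\<sigma> | \<sigma> permutes {..<2*n}. - (of_int (sign \<sigma>) *
      (\<Prod>j<n. a (Transposition.transpose p q (\<sigma> (2*j))) (Transposition.transpose p q (\<sigma> (2*j+1))))))"
  proof (rule sum.cong)
    fix \<sigma> assume "\<sigma> \<in> {\<sigma>. \<sigma> permutes {..<2*n}}"
    then have "permutation \<sigma>" by (auto simp: permutation_permutes)
    then have "sign (Transposition.transpose p q \<circ> \<sigma>) = - sign \<sigma>"
      using assms by (simp add: sign_compose sign_swap_id permutation_swap_id)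
    then show "of_int (sign (Transposition.transpose p q \<circ> \<sigma>)) *
        (\<Prod>j<n. a ((Transposition.transpose p q \<circ> \<sigma>) (2*j)) ((Transposition.transpose p q \<circ> \<sigma>) (2*j+1))) = - (of_int (sign \<sigma>) *
        (\<Prod>j<n. a (Transposition.transpose p q (\<sigma> (2*j))) (Transposition.transpose p q (\<sigma> (2*j+1)))))"
      by simp
  qed simp
  finally show ?thesis by (simp add: pairing_sum_def sum_negf)
qed

context
  fixes \<alpha> :: "'v::real_vector \<Rightarrow> 'v \<Rightarrow> real"
  assumes bilin: "bilinear \<alpha>"
begin

lemma pairing_sum_repeated:
  assumes "p < 2*n" "q < 2*n" "p \<noteq> q" "v p = v q"
  shows "pairing_sum n (\<lambda>i j. \<alpha> (v i) (v j)) = 0"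
proof -
  have "v (Transposition.transpose p q i) = v i" for i using assms(4) by (auto simp: Transposition.transpose_def)
  then show ?thesis using pairing_sum_transpose[OF assms(1-3), of "\<lambda>i j. \<alpha> (v i) (v j)"] by simp
qed

text \<open>In the product belonging to one permutation, the index \<open>k\<close> occurs in exactly one factor, namely the
one whose position is half the preimage of \<open>k\<close>; bilinearity is applied to that factor.\<close>

lemma pairing_sum_slot_linear:
  assumes k: "k < 2*n"
  shows "pairing_sum n (\<lambda>i j. \<alpha> ((v(k := x + c *\<^sub>R y)) i) ((v(k := x + c *\<^sub>R y)) j)) =
         pairing_sum n (\<lambda>i j. \<alpha> ((v(k := x)) i) ((v(k := x)) j)) +
         c * pairing_sum n (\<lambda>i j. \<alpha> ((v(k := y)) i) ((v(k := y)) j))"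
  unfolding pairing_sum_def sum_distrib_left sum.distrib[symmetric]
proof (rule sum.cong[OF refl])
  fix \<sigma> assume "\<sigma> \<in> {\<sigma>. \<sigma> permutes {..<2*n}}"
  then have \<sigma>: "\<sigma> permutes {..<2*n}" by simp
  define i0 where "i0 = inv \<sigma> k"
  define j0 where "j0 = i0 div 2"
  define h where "h u j = \<alpha> ((v(k := u)) (\<sigma> (2*j))) ((v(k := u)) (\<sigma> (2*j+1)))" for u j
  have hit: "\<sigma> i = k \<longleftrightarrow> i = i0" for i
    unfolding i0_def using \<sigma> by (metis permutes_inverses(1) permutes_inverses(2))
  have "inv \<sigma> k \<in> {..<2*n}" using permutes_in_image[OF permutes_inv[OF \<sigma>]] k by simp
  then have j0: "j0 < n" by (simp add: j0_def i0_def less_mult_imp_div_less mult.commute)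
  have other: "h u j = h 0 j" if "j \<noteq> j0" for u j
    using that unfolding h_def fun_upd_apply hit j0_def by auto
  have split: "(\<Prod>j<n. h u j) = h u j0 * (\<Prod>j\<in>{..<n} - {j0}. h 0 j)" for u
  proof -
    have "(\<Prod>j<n. h u j) = h u j0 * (\<Prod>j\<in>{..<n} - {j0}. h u j)"
      using j0 by (intro prod.remove) auto
    also have "(\<Prod>j\<in>{..<n} - {j0}. h u j) = (\<Prod>j\<in>{..<n} - {j0}. h 0 j)"
      by (intro prod.cong) (auto simp: other[of _ u])
    finally show ?thesis .
  qed
  have "i0 = 2*j0 \<or> i0 = 2*j0 + 1" by (auto simp: j0_def)
  then have "h (x + c *\<^sub>R y) j0 = h x j0 + c * h y j0"
    unfolding h_def fun_upd_apply hit
    by (auto simp: bilinear_ladd[OF bilin] bilinear_radd[OF bilin] bilinear_lmul[OF bilin] bilinear_rmul[OF bilin])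
  then have "(\<Prod>j<n. h (x + c *\<^sub>R y) j) = (\<Prod>j<n. h x j) + c * (\<Prod>j<n. h y j)"
    unfolding split by (simp add: algebra_simps)
  then show "of_int (sign \<sigma>) * (\<Prod>j<n. \<alpha> ((v(k := x + c *\<^sub>R y)) (\<sigma> (2*j))) ((v(k := x + c *\<^sub>R y)) (\<sigma> (2*j+1)))) =
    of_int (sign \<sigma>) * (\<Prod>j<n. \<alpha> ((v(k := x)) (\<sigma> (2*j))) ((v(k := x)) (\<sigma> (2*j+1)))) +
    c * (of_int (sign \<sigma>) * (\<Prod>j<n. \<alpha> ((v(k := y)) (\<sigma> (2*j))) ((v(k := y)) (\<sigma> (2*j+1)))))"
    unfolding h_def[symmetric] by (simp add: algebra_simps)
qed

lemma pairing_sum_add_slot: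
  assumes "k < 2*n" "l < 2*n" "k \<noteq> l"
  shows "pairing_sum n (\<lambda>i j. \<alpha> ((v(k := x + c *\<^sub>R v l)) i) ((v(k := x + c *\<^sub>R v l)) j)) =
         pairing_sum n (\<lambda>i j. \<alpha> ((v(k := x)) i) ((v(k := x)) j))"
  using pairing_sum_slot_linear[OF assms(1), of v x c "v l"]
    pairing_sum_repeated[OF assms, of "v(k := v l)"] assms by simp

text \<open>The row operation of Gaussian elimination: adding multiples of the two pivot vectors \<open>v p\<close> and \<open>v q\<close> to
the earlier vectors does not change an alternating multilinear expression.\<close>

lemma pairing_sum_eliminate:
  fixes v :: "nat \<Rightarrow> 'v" and c d :: "nat \<Rightarrow> real"
  assumes "m \<le> p" "m \<le> q" "p < 2*n" "q < 2*n"
  defines "w \<equiv> \<lambda>m k. if k < m then v k + c k *\<^sub>R v p + d k *\<^sub>R v q else v k"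
  shows "pairing_sum n (\<lambda>i j. \<alpha> (w m i) (w m j)) = pairing_sum n (\<lambda>i j. \<alpha> (v i) (v j))"
  using assms(1,2)
proof (induction m)
  case 0
  then show ?case by (simp add: w_def)
next
  case (Suc m)
  have 1: "w (Suc m) = (w m)(m := (v m + c m *\<^sub>R w m p) + d m *\<^sub>R w m q)"
    using Suc.prems by (auto simp: w_def fun_eq_iff)
  have 2: "(w m)(m := v m) = w m" by (auto simp: w_def fun_eq_iff)
  have m: "m < 2*n" "m \<noteq> p" "m \<noteq> q" using Suc.prems assms(3) by auto
  have "pairing_sum n (\<lambda>i j. \<alpha> (w (Suc m) i) (w (Suc m) j)) =
      pairing_sum n (\<lambda>i j. \<alpha> (((w m)(m := v m)) i) (((w m)(m := v m)) j))"
    unfolding 1 by (simp only: pairing_sum_add_slot[OF m(1) assms(4) m(3)] pairing_sum_add_slot[OF m(1) assms(3) m(2)])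
  then show ?case unfolding 2 using Suc by simp
qed

end

text \<open>If the last two indices are paired with each other only, then every nonzero term has the pair
\<open>{2n, 2n+1}\<close> in one of its \<open>n + 1\<close> factors, in one of two orders. All these \<open>2(n + 1)\<close> choices contribute
equally: moving a pair of positions is an even permutation, and exchanging the two entries
changes both the sign of the permutation and the sign of \<open>a\<close>.\<close>

lemma pairing_sum_split:
  assumes anti: "\<And>i j. a i j = - a j i"
    and zero: "\<And>i. i < 2*n \<Longrightarrow> a i (2*n) = 0" "\<And>i. i < 2*n \<Longrightarrow> a i (2*n+1) = 0"
  shows "pairing_sum (Suc n) a = 2 * real (Suc n) * a (2*n) (2*n+1) * pairing_sum n a"
proof -
  define N where "N = 2*n"
  define S where "S = {\<sigma>. \<sigma> permutes {..<2*Suc n}}"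
  define F where "F \<sigma> = of_int (sign \<sigma>) * (\<Prod>j<Suc n. a (\<sigma> (2*j)) (\<sigma> (2*j+1)))" for \<sigma> :: "nat \<Rightarrow> nat"
  define T where "T j = {\<sigma>\<in>S. {\<sigma> (2*j), \<sigma> (2*j+1)} = {N, N+1}}" for j
  have finS: "finite S" by (auto simp: S_def finite_permutations)
  have inj: "\<sigma> i = \<sigma> j \<longleftrightarrow> i = j" if "\<sigma> \<in> S" for \<sigma> i j
    using that by (auto simp: S_def dest: permutes_inj injD)
  \<comment> \<open>\<open>T j\<close> collects the permutations with the pair \<open>{N, N+1}\<close> in factor \<open>j\<close>. Outside these sets the partner of \<open>N\<close> is an earlier index.\<close>
  have vanish: "F \<sigma> = 0" if \<sigma>: "\<sigma> \<in> S" "\<sigma> \<notin> (\<Union>j<Suc n. T j)" for \<sigma>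
  proof -
    have p: "\<sigma> permutes {..<2*Suc n}" using \<sigma> by (simp add: S_def)
    define i0 where "i0 = inv \<sigma> N"
    have i0: "\<sigma> i0 = N" using p by (simp add: i0_def permutes_inverses)
    have "i0 \<in> {..<2*Suc n}"
      unfolding i0_def using permutes_in_image[OF permutes_inv[OF p]] by (simp add: N_def)
    then have j: "i0 div 2 < Suc n" by auto
    have lt: "\<sigma> i < 2*n + 2" if "i < 2*n+2" for i
      using permutes_in_image[OF p, of i] that by simp
    have ne: "{\<sigma> (2*(i0 div 2)), \<sigma> (2*(i0 div 2)+1)} \<noteq> {N, N+1}"
      using \<sigma> j unfolding T_def by blast
    have "a (\<sigma> (2*(i0 div 2))) (\<sigma> (2*(i0 div 2)+1)) = 0"
    proof (cases "even i0")
      case True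
      then have e: "2 * (i0 div 2) = i0" by simp
      have "\<sigma> (i0+1) \<noteq> N+1" using ne i0 unfolding e by auto
      moreover have "\<sigma> (i0+1) \<noteq> N" using inj[OF \<sigma>(1), of "i0+1" i0] i0 by auto
      moreover have "\<sigma> (i0+1) < 2*n+2" using lt j e by auto
      ultimately have "\<sigma> (i0+1) < 2*n" by (auto simp: N_def)
      then show ?thesis using zero anti[of N] by (simp add: e i0) (simp add: N_def)
    next
      case False
      then have e: "2 * (i0 div 2) + 1 = i0" by simp
      define i1 where "i1 = 2 * (i0 div 2)"
      have e1: "i0 = i1 + 1" using e by (simp add: i1_def)
      have "\<sigma> i1 \<noteq> N+1" using ne i0 unfolding e by (auto simp: i1_def)
      moreover have "\<sigma> i1 \<noteq> N" using inj[OF \<sigma>(1), of i1 i0] i0 e1 by auto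
      moreover have "\<sigma> i1 < 2*n+2" using lt j e1 e by auto
      ultimately have "\<sigma> i1 < 2*n" by (auto simp: N_def)
      then have "a (\<sigma> i1) (\<sigma> i0) = 0" unfolding i0 N_def by (rule zero(1))
      then show ?thesis unfolding i1_def[symmetric] e1[symmetric] .
    qed
    then have "(\<Prod>j<Suc n. a (\<sigma> (2*j)) (\<sigma> (2*j+1))) = 0"
      using j by (intro prod_zero bexI[of _ "i0 div 2"]) simp_all
    then show ?thesis unfolding F_def by (simp only: mult_zero_right)
  qed
  have disj: "T i \<inter> T j = {}" if "i \<noteq> j" for i j
  proof -
    have False if "\<sigma> \<in> T i" "\<sigma> \<in> T j" for \<sigma>
    proof -
      have "\<sigma> \<in> S" using that by (simp add: T_def)
      have "\<sigma> (2*i) \<in> {\<sigma> (2*j), \<sigma> (2*j+1)}" using that unfolding T_def by blast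
      then show False using inj[OF \<open>\<sigma> \<in> S\<close>] \<open>i \<noteq> j\<close> by (simp; presburger)
    qed
    then show ?thesis by blast
  qed
  have "pairing_sum (Suc n) a = sum F S" by (simp add: pairing_sum_def F_def S_def)
  also have "\<dots> = sum F (\<Union>j<Suc n. T j)"
    by (rule sum.mono_neutral_right) (use finS vanish in \<open>auto simp: T_def\<close>)
  also have "\<dots> = (\<Sum>j<Suc n. sum F (T j))"
    using finS disj by (intro sum.UNION_disjoint) (auto simp: T_def)
  also have "\<dots> = (\<Sum>j<Suc n. sum F (T n))"
  proof (rule sum.cong[OF refl])
    fix j assume "j \<in> {..<Suc n}"
    then have j: "j \<le> n" by simp
    \<comment> \<open>Exchanges the position pairs \<open>j\<close> and \<open>n\<close>, and so only reorders the factors.\<close>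
    define \<pi> where "\<pi> = Transposition.transpose (2*j) (2*n) \<circ> Transposition.transpose (2*j+1) (2*n+1)"
    have pi1: "\<pi> (2*i) = 2 * Transposition.transpose j n i" "\<pi> (2*i+1) = 2 * Transposition.transpose j n i + 1" for i
      by (auto simp: \<pi>_def Transposition.transpose_def; presburger)+
    have pp: "\<pi> permutes {..<2*Suc n}"
      unfolding \<pi>_def using j by (intro permutes_compose permutes_swap_id) auto
    have invol: "\<pi> \<circ> \<pi> = id"
    proof
      fix i show "(\<pi> \<circ> \<pi>) i = id i"
        using pi1[of "i div 2"] pi1[of "Transposition.transpose j n (i div 2)"] by (cases "even i") auto
    qed
    have sg: "sign \<pi> = 1"
      unfolding \<pi>_def by (simp add: sign_compose permutation_swap_id sign_swap_id)
    have FT: "F (\<sigma> \<circ> \<pi>) = F \<sigma>" if "\<sigma> \<in> S" for \<sigma>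
    proof -
      have "permutation \<sigma>" "permutation \<pi>" using that pp by (auto simp: S_def permutation_permutes)
      then have "sign (\<sigma> \<circ> \<pi>) = sign \<sigma>" using sg by (simp add: sign_compose)
      moreover have "(\<Prod>i<Suc n. a (\<sigma> (2*i)) (\<sigma> (2*i+1))) =
          (\<Prod>i<Suc n. a (\<sigma> (2*Transposition.transpose j n i)) (\<sigma> (2*Transposition.transpose j n i+1)))"
        by (rule prod.permute[of "Transposition.transpose j n" "{..<Suc n}" "\<lambda>i. a (\<sigma> (2*i)) (\<sigma> (2*i+1))", unfolded o_def])
           (use j in \<open>auto intro: permutes_swap_id\<close>)
      ultimately show ?thesis by (simp only: F_def o_apply pi1)
    qed
    have comp: "\<sigma> \<circ> \<pi> \<in> S" if "\<sigma> \<in> S" for \<sigma>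
      using that pp permutes_compose by (auto simp: S_def)
    have swapT: "\<sigma> \<circ> \<pi> \<in> T (Transposition.transpose j n i)" if "\<sigma> \<in> T i" for \<sigma> i
      using that comp unfolding T_def by (simp only: mem_Collect_eq o_apply pi1 Transposition.transpose_involutory)
    show "sum F (T j) = sum F (T n)"
      by (rule sum.reindex_bij_witness[of _ "\<lambda>\<sigma>. \<sigma> \<circ> \<pi>" "\<lambda>\<sigma>. \<sigma> \<circ> \<pi>"])
         (use swapT[of _ j] swapT[of _ n] FT in \<open>auto simp: o_assoc[symmetric] invol T_def\<close>)
  qed
  also have "\<dots> = real (Suc n) * sum F (T n)" by simp
  also have "sum F (T n) = 2 * (a N (N+1) * pairing_sum n a)"
  proof -
    define T1 where "T1 = {\<sigma>. \<sigma> permutes {..<2*n}}"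
    define \<tau> where "\<tau> = Transposition.transpose N (N+1)"
    have pt: "\<tau> permutes {..<2*Suc n}"
      unfolding \<tau>_def N_def by (intro permutes_swap_id) auto
    have t1: "\<tau> N = N+1" "\<tau> (N+1) = N" "\<And>i. i < N \<Longrightarrow> \<tau> i = i" by (auto simp: \<tau>_def Transposition.transpose_def)
    have inv: "\<tau> \<circ> \<tau> = id" by (simp add: \<tau>_def)
    have T1: "T1 = {\<sigma>\<in>S. \<sigma> N = N \<and> \<sigma> (N+1) = N+1}"
    proof (intro equalityI subsetI)
      fix \<sigma> assume "\<sigma> \<in> T1"
      then have "\<sigma> permutes {..<2*n}" by (simp add: T1_def)
      then show "\<sigma> \<in> {\<sigma>\<in>S. \<sigma> N = N \<and> \<sigma> (N+1) = N+1}"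
        by (auto simp: S_def N_def permutes_not_in intro: permutes_subset)
    next
      fix \<sigma> assume "\<sigma> \<in> {\<sigma>\<in>S. \<sigma> N = N \<and> \<sigma> (N+1) = N+1}"
      then have "\<sigma> permutes {..<2*Suc n}" "\<sigma> N = N" "\<sigma> (N+1) = N+1" by (auto simp: S_def)
      then have "\<sigma> permutes {..<2*n}"
        by (elim permutes_superset) (auto simp: N_def less_Suc_eq)
      then show "\<sigma> \<in> T1" by (simp add: T1_def)
    qed
    \<comment> \<open>\<open>T n\<close> consists of the permutations that fix \<open>N\<close> and \<open>N+1\<close> and of those that exchange them.\<close>
    have F1: "F \<sigma> = a N (N+1) * (of_int (sign \<sigma>) * (\<Prod>j<n. a (\<sigma> (2*j)) (\<sigma> (2*j+1))))" if "\<sigma> \<in> T1" for \<sigma>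
      using that by (simp add: F_def T1 N_def)
    have F2: "F (\<sigma> \<circ> \<tau>) = F \<sigma>" if "\<sigma> \<in> T1" for \<sigma>
    proof -
      have "permutation \<sigma>" using that by (auto simp: T1_def permutation_permutes)
      then have "sign (\<sigma> \<circ> \<tau>) = - sign \<sigma>"
        by (simp add: \<tau>_def sign_compose permutation_swap_id sign_swap_id)
      moreover have "(\<Prod>j<n. a ((\<sigma> \<circ> \<tau>) (2*j)) ((\<sigma> \<circ> \<tau>) (2*j+1))) = (\<Prod>j<n. a (\<sigma> (2*j)) (\<sigma> (2*j+1)))"
        by (intro prod.cong) (auto simp: t1 N_def)
      moreover have "a ((\<sigma> \<circ> \<tau>) (2*n)) ((\<sigma> \<circ> \<tau>) (2*n+1)) = - a (\<sigma> (2*n)) (\<sigma> (2*n+1))"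
        using that t1 anti[of "N+1" N] by (simp add: T1 N_def)
      ultimately show ?thesis by (simp add: F_def)
    qed
    have Tn: "T n = T1 \<union> (\<lambda>\<sigma>. \<sigma> \<circ> \<tau>) ` T1"
    proof (intro equalityI subsetI)
      fix \<sigma> assume s: "\<sigma> \<in> T n"
      show "\<sigma> \<in> T1 \<union> (\<lambda>\<sigma>. \<sigma> \<circ> \<tau>) ` T1"
      proof (cases "\<sigma> N = N")
        case True
        then show ?thesis using s by (auto simp: T_def T1 N_def doubleton_eq_iff)
      next
        case False
        then have "\<sigma> N = N+1" "\<sigma> (N+1) = N" "\<sigma> \<in> S" using s by (auto simp: T_def N_def doubleton_eq_iff)
        then have "\<sigma> \<circ> \<tau> \<in> T1" using t1 pt by (auto simp: T1 S_def permutes_compose)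
        moreover have "\<sigma> = (\<sigma> \<circ> \<tau>) \<circ> \<tau>" by (simp add: o_assoc[symmetric] inv)
        ultimately show ?thesis by blast
      qed
    next
      fix \<sigma> assume "\<sigma> \<in> T1 \<union> (\<lambda>\<sigma>. \<sigma> \<circ> \<tau>) ` T1"
      then show "\<sigma> \<in> T n"
        using t1 pt by (auto simp: T1 T_def S_def permutes_compose N_def)
    qed
    have inj2: "inj_on (\<lambda>\<sigma>. \<sigma> \<circ> \<tau>) T1"
      by (rule inj_on_inverseI[where g = "\<lambda>\<sigma>. \<sigma> \<circ> \<tau>"]) (simp add: o_assoc[symmetric] inv)
    have dj: "T1 \<inter> (\<lambda>\<sigma>. \<sigma> \<circ> \<tau>) ` T1 = {}" using t1 by (auto simp: T1)
    have "finite T1" by (auto simp: T1_def finite_permutations)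
    then have "sum F (T n) = sum F T1 + sum F T1"
      unfolding Tn using dj inj2 F2 by (simp add: sum.union_disjoint sum.reindex)
    also have "sum F T1 = a N (N+1) * pairing_sum n a"
      unfolding pairing_sum_def sum_distrib_left T1_def[symmetric] using F1 by (intro sum.cong) auto
    finally show ?thesis by simp
  qed
  finally show ?thesis by (simp add: N_def)
qed

text \<open>The sequence \<open>f 0, \<i> f 0, f 1, \<i> f 1, \<dots>\<close> of real vectors belonging to a sequence of complex ones.\<close>

definition realified_frame :: "(nat \<Rightarrow> complex^'n) \<Rightarrow> nat \<Rightarrow> complex^'n" where
  "realified_frame f k = (if even k then f (k div 2) else \<i> *s f (k div 2))"

lemma complex_scale_eq: "z *s v = Re z *\<^sub>R v + Im z *\<^sub>R (\<i> *s (v :: complex^'n))"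
  by (simp add: vec_eq_iff complex_eq_iff)

text \<open>Elimination with the pivots \<open>e = f m\<close> and \<open>\<i> e\<close>: subtracting complex multiples of \<open>e\<close> makes the
remaining vectors \<open>\<alpha>\<close>-orthogonal to both pivots, and the pivots split off the positive factor
\<open>\<alpha>(e, \<i> e)\<close>. The modified vectors are still complex linearly independent, so the induction
hypothesis applies to them. The invariance of \<open>\<alpha>\<close> under \<open>\<i>\<close> is what makes one complex multiple achieve
all four orthogonality relations for \<open>f j\<close> and \<open>\<i> f j\<close>.\<close>

lemma pairing_sum_realified_frame_pos:
  fixes \<alpha> :: "complex^'n::finite \<Rightarrow> complex^'n \<Rightarrow> real"
  assumes bilin: "bilinear \<alpha>" and alt: "\<And>v. \<alpha> v v = 0"
    and J: "\<And>v w. \<alpha> (\<i> *s v) (\<i> *s w) = \<alpha> v w" and pos: "\<And>v. v \<noteq> 0 \<Longrightarrow> \<alpha> v (\<i> *s v) > 0"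
    and indep: "\<And>c. (\<Sum>j<m. c j *s f j) = 0 \<Longrightarrow> \<forall>j<m. c j = 0"
  shows "pairing_sum m (\<lambda>i j. \<alpha> (realified_frame f i) (realified_frame f j)) > 0"
  using indep
proof (induction m arbitrary: f)
  case 0
  have "{\<sigma>. \<sigma> permutes {..<2*0::nat}} = {id}" by auto
  then show ?case by (simp add: pairing_sum_def)
next
  case (Suc m)
  note lin = bilinear_ladd[OF bilin] bilinear_radd[OF bilin] bilinear_lmul[OF bilin] bilinear_rmul[OF bilin]
    bilinear_lneg[OF bilin] bilinear_rneg[OF bilin] bilinear_lsub[OF bilin] bilinear_rsub[OF bilin]
  have anti: "\<alpha> v w = - \<alpha> w v" for v w
  proof -
    have "\<alpha> (v + w) (v + w) = \<alpha> v v + \<alpha> v w + \<alpha> w v + \<alpha> w w" by (simp add: lin)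
    then show ?thesis using alt[of "v + w"] alt[of v] alt[of w] by linarith
  qed
  have ii: "\<i> *s (\<i> *s v) = - v" for v :: "complex^'n" by (simp add: vec_eq_iff)
  define e where "e = f m"
  define G where "G = \<alpha> e (\<i> *s e)"
  have "e \<noteq> 0"
  proof
    assume "e = 0"
    then have "(\<Sum>j<Suc m. (if j = m then 1 else 0) *s f j) = 0"
      by (simp add: e_def if_distrib[of "\<lambda>c. c *s _"] cong: if_cong) 
    then show False using Suc.prems by fastforce
  qed
  then have G: "G > 0" using pos by (simp add: G_def)
  \<comment> \<open>Real and imaginary part of the coefficient for which \<open>f j + (x + \<i> y) e\<close> is orthogonal to \<open>e\<close> and \<open>\<i> e\<close>.\<close>
  define x where "x j = - \<alpha> (f j) (\<i> *s e) / G" for j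
  define y where "y j = \<alpha> (f j) e / G" for j
  define f' where "f' j = (if j < m then f j + Complex (x j) (y j) *s e else f j)" for j
  have f': "f' j = f j + x j *\<^sub>R e + y j *\<^sub>R (\<i> *s e)" if "j < m" for j
    using that complex_scale_eq[of "Complex (x j) (y j)" e] by (simp add: f'_def)
  have if': "\<i> *s f' j = \<i> *s f j + (- y j) *\<^sub>R e + x j *\<^sub>R (\<i> *s e)" if "j < m" for j
    using that by (simp add: f'_def vec_eq_iff complex_eq_iff)
  have orth: "\<alpha> (f' j) e = 0" "\<alpha> (f' j) (\<i> *s e) = 0" if "j < m" for j
    unfolding f'[OF that] using G anti[of "\<i> *s e" e]
    by (simp_all add: lin alt x_def y_def flip: G_def)
  have iorth: "\<alpha> (\<i> *s f' j) e = 0" "\<alpha> (\<i> *s f' j) (\<i> *s e) = 0" if "j < m" for j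
  proof -
    show "\<alpha> (\<i> *s f' j) (\<i> *s e) = 0" using J orth(1)[OF that] by simp
    have "\<alpha> (\<i> *s f' j) e = \<alpha> (\<i> *s (\<i> *s f' j)) (\<i> *s e)" by (simp only: J)
    then show "\<alpha> (\<i> *s f' j) e = 0" using orth(2)[OF that] by (simp add: ii lin)
  qed
  define c where "c k = (if even k then x (k div 2) else - y (k div 2))" for k
  define d where "d k = (if even k then y (k div 2) else x (k div 2))" for k
  have frame': "realified_frame f' = (\<lambda>k. if k < 2*m then realified_frame f k + c k *\<^sub>R realified_frame f (2*m)
      + d k *\<^sub>R realified_frame f (2*m+1) else realified_frame f k)"
  proof
    fix k
    have "k div 2 < m \<longleftrightarrow> k < 2*m" by auto
    then show "realified_frame f' k = (if k < 2*m then realified_frame f k + c k *\<^sub>R realified_frame f (2*m)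
      + d k *\<^sub>R realified_frame f (2*m+1) else realified_frame f k)"
      using f'[of "k div 2"] if'[of "k div 2"]
      by (auto simp: realified_frame_def c_def d_def e_def f'_def[of "k div 2"])
  qed
  have last: "realified_frame f' (2*m) = e" "realified_frame f' (2*m+1) = \<i> *s e"
    by (auto simp: realified_frame_def f'_def e_def)
  have zero: "\<alpha> (realified_frame f' i) e = 0" "\<alpha> (realified_frame f' i) (\<i> *s e) = 0" if "i < 2*m" for i
    using orth[of "i div 2"] iorth[of "i div 2"] that by (auto simp: realified_frame_def)
  have "pairing_sum (Suc m) (\<lambda>i j. \<alpha> (realified_frame f i) (realified_frame f j)) =
        pairing_sum (Suc m) (\<lambda>i j. \<alpha> (realified_frame f' i) (realified_frame f' j))"
    unfolding frame' by (rule pairing_sum_eliminate[OF bilin, symmetric]) auto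
  also have "\<dots> = 2 * real (Suc m) * \<alpha> (realified_frame f' (2*m)) (realified_frame f' (2*m+1)) *
      pairing_sum m (\<lambda>i j. \<alpha> (realified_frame f' i) (realified_frame f' j))"
  proof (rule pairing_sum_split[where a = "\<lambda>i j. \<alpha> (realified_frame f' i) (realified_frame f' j)"])
    show "\<alpha> (realified_frame f' i) (realified_frame f' j) = - \<alpha> (realified_frame f' j) (realified_frame f' i)" for i j
      by (rule anti)
  qed (simp_all only: last zero)
  also have "\<alpha> (realified_frame f' (2*m)) (realified_frame f' (2*m+1)) = G"
    unfolding last G_def ..
  finally have eq: "pairing_sum (Suc m) (\<lambda>i j. \<alpha> (realified_frame f i) (realified_frame f j)) =
      2 * real (Suc m) * G * pairing_sum m (\<lambda>i j. \<alpha> (realified_frame f' i) (realified_frame f' j))" .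
  have "pairing_sum m (\<lambda>i j. \<alpha> (realified_frame f' i) (realified_frame f' j)) > 0"
  proof (rule Suc.IH)
    fix b :: "nat \<Rightarrow> complex"
    assume b: "(\<Sum>j<m. b j *s f' j) = 0"
    \<comment> \<open>A relation among the modified vectors is one among the original vectors, with this coefficient at \<open>e\<close>.\<close>
    define b' where "b' j = (if j < m then b j else \<Sum>j<m. b j * Complex (x j) (y j))" for j
    have "(\<Sum>j<Suc m. b' j *s f j) = (\<Sum>j<m. b j *s f j) + (\<Sum>j<m. b j * Complex (x j) (y j)) *s e"
      by (simp add: b'_def e_def)
    also have "\<dots> = (\<Sum>j<m. b j *s f' j)"
      by (simp add: f'_def sum.distrib vector_add_ldistrib vec.scale_sum_left)
    finally have "\<forall>j<Suc m. b' j = 0" using Suc.prems b by simp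
    then show "\<forall>j<m. b j = 0" by (auto simp: b'_def less_Suc_eq)
  qed
  then show ?case unfolding eq using G by simp
qed

lemma wedge_power_pos:
  fixes \<alpha> :: "complex^'n::finite \<Rightarrow> complex^'n \<Rightarrow> real"
  assumes "bilinear \<alpha>" "\<And>v. \<alpha> v v = 0"
    "\<And>v w. \<alpha> (\<i> *s v) (\<i> *s w) = \<alpha> v w" "\<And>v. v \<noteq> 0 \<Longrightarrow> \<alpha> v (\<i> *s v) > 0"
  shows "wedge_power CARD('n) \<alpha> complex_frame > 0"
proof -
  define b where "b = (SOME b :: nat \<Rightarrow> 'n. bij_betw b {..<CARD('n)} UNIV)"
  define f where "f j = (axis (b j) 1 :: complex^'n)" for j
  have "\<exists>b :: nat \<Rightarrow> 'n. bij_betw b {..<CARD('n)} UNIV"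
    using ex_bij_betw_nat_finite[of "UNIV :: 'n set"] by (simp add: lessThan_atLeast0)
  then have b: "bij_betw b {..<CARD('n)} UNIV" unfolding b_def by (rule someI_ex)
  have frame: "complex_frame = realified_frame f"
    by (auto simp: fun_eq_iff complex_frame_def realified_frame_def f_def Let_def vec_eq_iff axis_def simp flip: b_def)
  have "pairing_sum CARD('n) (\<lambda>i j. \<alpha> (realified_frame f i) (realified_frame f j)) > 0"
  proof (rule pairing_sum_realified_frame_pos[OF assms])
    fix c :: "nat \<Rightarrow> complex"
    assume "(\<Sum>j<CARD('n). c j *s f j) = 0"
    then have 0: "(\<Sum>j<CARD('n). c j * (f j $ b i)) = 0" for i
      by (simp add: vec_eq_iff)
    show "\<forall>j<CARD('n). c j = 0"
    proof (intro allI impI)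
      fix i assume i: "i < CARD('n)"
      have "(\<Sum>j<CARD('n). c j * (f j $ b i)) = (\<Sum>j<CARD('n). if j = i then c j else 0)"
        using b i by (intro sum.cong) (auto simp: f_def axis_def bij_betw_def inj_on_eq_iff)
      then show "c i = 0" using 0[of i] i by simp
    qed
  qed
  then show ?thesis by (simp add: wedge_power_pairing_sum frame)
qed

section \<open>Partitions of unity on compact Hausdorff spaces\<close>

text \<open>A Urysohn function that is 0 off \<open>U\<close> is cut off at height 1/2: its support then
lies in the closed set where it is at least 1/2, hence in \<open>U\<close>.\<close>

lemma compact_t2_bump:
  fixes x :: "'a::t2_space"
  assumes "compact (UNIV :: 'a set)" "open U" "x \<in> U"
  obtains f :: "'a \<Rightarrow> real"
  where "continuous_on UNIV f" "\<And>y. f y \<ge> 0" "f x > 0" "closure {y. f y \<noteq> 0} \<subseteq> U"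
proof -
  have "Hausdorff_space (euclidean :: 'a topology)"
    unfolding Hausdorff_space_def disjnt_def using hausdorff by fastforce
  moreover have "compact_space (euclidean :: 'a topology)"
    using assms(1) by (simp add: compact_space_def)
  ultimately have "normal_space (euclidean :: 'a topology)"
    by (simp add: compact_Hausdorff_or_regular_imp_normal_space)
  moreover have "closedin euclidean (- U)" "closedin euclidean {x}" "disjnt (- U) {x}"
    using assms by auto
  ultimately obtain f :: "'a \<Rightarrow> real" where f: "continuous_map euclidean (top_of_set {0..1}) f"
    "f ` (- U) \<subseteq> {0}" "f ` {x} \<subseteq> {1}"
    by (rule Urysohn_lemma[where a = 0 and b = 1]) auto
  have cf: "continuous_on UNIV f"
    using f(1) by (simp add: continuous_map_in_subtopology)
  show thesis
  proof
    show "continuous_on UNIV (\<lambda>y. max 0 (f y - 1/2))"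
      by (intro continuous_intros cf)
    have "closed {y. f y \<ge> 1/2}"
      using cf by (intro closed_Collect_le continuous_on_const) auto
    then have "closure {y. max 0 (f y - 1/2) \<noteq> 0} \<subseteq> {y. f y \<ge> 1/2}"
      by (rule closure_minimal[rotated]) auto
    also have "\<dots> \<subseteq> U"
    proof
      fix y assume "y \<in> {y. f y \<ge> 1/2}"
      then have "f y \<noteq> 0" by auto
      then show "y \<in> U" using f(2) by blast
    qed
    finally show "closure {y. max 0 (f y - 1/2) \<noteq> 0} \<subseteq> U" .
  qed (use f in auto)
qed

text \<open>Finitely many bump functions, each supported in some chart domain, have a positive sum \<open>S\<close>. Bumps that
were assigned the same chart are added up, and the results are divided by \<open>S\<close>. The integral is
defined by a choice among partitions of unity, so all its properties rest on this existence result.\<close>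

lemma partition_of_unity_exists:
  fixes A :: "('a::t2_space, 'n::finite) chart set"
  assumes comp: "compact (UNIV :: 'a set)" and atlas: "complex_atlas A"
  shows "\<exists>C \<rho>. partition_of_unity A C \<rho>"
proof -
  have "\<exists>c. \<exists>f :: 'a \<Rightarrow> real. c \<in> A \<and> continuous_on UNIV f \<and> (\<forall>y. f y \<ge> 0) \<and> f x > 0 \<and> closure {y. f y \<noteq> 0} \<subseteq> fst c"
    for x :: 'a
  proof -
    have "x \<in> (\<Union>c\<in>A. fst c)" using atlas by (simp add: complex_atlas_def)
    then obtain c where c: "c \<in> A" "x \<in> fst c" by blast
    have "open (fst c)" using atlas c by (simp add: complex_atlas_def)
    then obtain f :: "'a \<Rightarrow> real"
      where "continuous_on UNIV f" "\<And>y. f y \<ge> 0" "f x > 0" "closure {y. f y \<noteq> 0} \<subseteq> fst c"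
      using compact_t2_bump[OF comp _ c(2)] by metis
    then show ?thesis using c by (intro exI[of _ c] exI[of _ f]) simp
  qed
  then obtain ch :: "'a \<Rightarrow> ('a, 'n) chart" and f :: "'a \<Rightarrow> 'a \<Rightarrow> real" where
    ch: "\<And>x. ch x \<in> A" and f: "\<And>x. continuous_on UNIV (f x)" "\<And>x y. f x y \<ge> 0" "\<And>x. f x x > 0"
      "\<And>x. closure {y. f x y \<noteq> 0} \<subseteq> fst (ch x)"
    by metis
  have op: "open {y. f x y > 0}" for x
    using f(1) by (intro open_Collect_less continuous_on_const) auto
  then obtain X where X: "finite X" "UNIV \<subseteq> (\<Union>x\<in>X. {y. f x y > 0})"
  proof (rule compactE_image[OF comp, of UNIV "\<lambda>x. {y. f x y > 0}"])
    show "UNIV \<subseteq> (\<Union>x\<in>UNIV. {y. f x y > 0})" using f(3) by auto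
  qed (use op in auto)
  define S where "S y = (\<Sum>x\<in>X. f x y)" for y
  have S: "S y > 0" for y
  proof -
    obtain x where "x \<in> X" "f x y > 0" using X(2) by blast
    then show ?thesis unfolding S_def using X(1) f(2) by (intro sum_pos2[of X x]) auto
  qed
  define \<rho> where "\<rho> c y = (\<Sum>x | x \<in> X \<and> ch x = c. f x y) / S y" for c y
  have "partition_of_unity A (ch ` X) \<rho>"
    unfolding partition_of_unity_def
  proof (intro conjI ballI allI)
    fix c assume "c \<in> ch ` X"
    have "continuous_on UNIV S" unfolding S_def by (intro continuous_on_sum f)
    then show "continuous_on UNIV (\<rho> c)"
      unfolding \<rho>_def using S by (intro continuous_on_divide continuous_on_sum f) (auto simp: less_imp_neq[symmetric])
    show "0 \<le> \<rho> c y" for y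
      unfolding \<rho>_def using S[of y] f(2) by (intro divide_nonneg_pos sum_nonneg) auto
    have "{y. \<rho> c y \<noteq> 0} \<subseteq> (\<Union>x\<in>{x\<in>X. ch x = c}. {y. f x y \<noteq> 0})"
      by (auto simp: \<rho>_def intro: ccontr dest: sum.not_neutral_contains_not_neutral)
    also have "\<dots> \<subseteq> (\<Union>x\<in>{x\<in>X. ch x = c}. closure {y. f x y \<noteq> 0})"
      by (intro UN_mono closure_subset subset_refl)
    finally have "closure {y. \<rho> c y \<noteq> 0} \<subseteq> (\<Union>x\<in>{x\<in>X. ch x = c}. closure {y. f x y \<noteq> 0})"
      using X(1) by (intro closure_minimal) auto
    also have "\<dots> \<subseteq> fst c" using f(4) by auto
    finally show "closure {y. \<rho> c y \<noteq> 0} \<subseteq> fst c" .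
  next
    fix y
    have "(\<Sum>c\<in>ch ` X. \<rho> c y) = (\<Sum>c\<in>ch ` X. \<Sum>x | x \<in> X \<and> ch x = c. f x y) / S y"
      by (simp add: \<rho>_def sum_divide_distrib)
    also have "(\<Sum>c\<in>ch ` X. \<Sum>x | x \<in> X \<and> ch x = c. f x y) = S y"
      unfolding S_def using X(1) by (intro sum.image_gen[symmetric])
    finally show "(\<Sum>c\<in>ch ` X. \<rho> c y) = 1" using S[of y] by simp
  qed (use X ch in auto)
  then show ?thesis by (intro exI)
qed

section \<open>Smooth families of functions\<close>

text \<open>A partial derivative in the parameter is a directional derivative along \<open>(u, 0)\<close>, so it
inherits joint smoothness.\<close>

lemma smooth_on_partial:
  assumes S: "open S" "smooth_on S (\<lambda>(p, z). g p z)"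
  shows "(p, z) \<in> S \<Longrightarrow> ((\<lambda>q. g q z) has_derivative (\<lambda>u. frechet_derivative (\<lambda>(p, z). g p z) (at (p, z)) (u, 0))) (at p)"
    and "smooth_on S (\<lambda>(p, z). frechet_derivative (\<lambda>q. g q z) (at p) u)"
proof -
  have d: "((\<lambda>q. g q z) has_derivative (\<lambda>u. frechet_derivative (\<lambda>(p, z). g p z) (at (p, z)) (u, 0))) (at p)"
    if "(p, z) \<in> S" for p z
  proof -
    have 1: "((\<lambda>q. (q, z)) has_derivative (\<lambda>u. (u, 0))) (at p)"
      by (intro has_derivative_Pair has_derivative_ident has_derivative_const)
    show ?thesis
      using has_derivative_compose[OF 1 smooth_on_has_derivative[OF S(2) that]] by simp
  qed
  then show "(p, z) \<in> S \<Longrightarrow> ((\<lambda>q. g q z) has_derivative (\<lambda>u. frechet_derivative (\<lambda>(p, z). g p z) (at (p, z)) (u, 0))) (at p)" .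
  show "smooth_on S (\<lambda>(p, z). frechet_derivative (\<lambda>q. g q z) (at p) u)"
    by (rule smooth_on_cong[OF S(1) _ smooth_on_directional_derivative[OF S(2), of "(u, 0)"]])
       (use d[THEN frechet_derivative_eqI] in auto)
qed

locale compact_kaehler =
  fixes A :: "('a::t2_space, 'n::finite) chart set" and \<omega> :: "('a, 'n) two_form"
  assumes kaehler: "compact_connected_kaehler A \<omega>"
begin

lemma compact_UNIV: "compact (UNIV :: 'a set)" and atlas: "complex_atlas A"
  using kaehler by (auto simp: compact_connected_kaehler_def)

lemma
  assumes "c \<in> A"
  shows open_chart: "open (fst c)" "open (chart_image c)"
    and chart_homeomorphism: "homeomorphism (fst c) (chart_image c) (snd c) (chart_inv c)"
  using atlas assms by (auto simp: complex_atlas_def)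

lemma chart_cover: obtains c where "c \<in> A" "x \<in> fst c"
proof -
  have "x \<in> (\<Union>c\<in>A. fst c)" using atlas by (simp add: complex_atlas_def)
  then show thesis using that by blast
qed

lemma
  assumes "c \<in> A"
  shows chart_inv_chart: "x \<in> fst c \<Longrightarrow> chart_inv c (snd c x) = x"
    and chart_in_image: "x \<in> fst c \<Longrightarrow> snd c x \<in> chart_image c"
    and chart_chart_inv: "z \<in> chart_image c \<Longrightarrow> snd c (chart_inv c z) = z"
    and chart_continuous: "continuous_on (fst c) (snd c)"
    and chart_inv_continuous: "continuous_on (chart_image c) (chart_inv c)"
  using chart_homeomorphism[OF assms] by (auto simp: homeomorphism_def chart_image_def)

lemma smooth_familyD:
  "smooth_family A P F \<Longrightarrow> c \<in> A \<Longrightarrow> smooth_on (P \<times> chart_image c) (\<lambda>(p, z). F p (chart_inv c z))"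
  by (simp add: smooth_family_def)

lemma smooth_family_cong:
  assumes "open P" "smooth_family A P F" "\<And>p x. p \<in> P \<Longrightarrow> F p x = G p x"
  shows "smooth_family A P G"
  unfolding smooth_family_def
proof
  fix c assume "c \<in> A"
  show "smooth_on (P \<times> chart_image c) (\<lambda>(p, z). G p (chart_inv c z))"
    by (rule smooth_on_cong[OF _ _ smooth_familyD[OF assms(2) \<open>c \<in> A\<close>]])
       (use assms open_chart[OF \<open>c \<in> A\<close>] in \<open>auto intro: open_Times\<close>)
qed

lemma smooth_family_const:
  assumes "open P" "smooth_fun A F"
  shows "smooth_family A P (\<lambda>_. F)"
  unfolding smooth_family_def
proof
  fix c assume c: "c \<in> A"
  have "smooth_on (P \<times> chart_image c) (\<lambda>x. F (chart_inv c (snd x + 0)))"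
    using assms c open_chart[OF c]
    by (intro smooth_on_compose_affine[where f = "\<lambda>z. F (chart_inv c z)" and S = "chart_image c"])
       (auto simp: smooth_fun_def bounded_linear_snd intro: open_Times)
  then show "smooth_on (P \<times> chart_image c) (\<lambda>(p, z). F (chart_inv c z))"
    by (simp add: case_prod_beta')
qed

lemma smooth_family_scalar:
  assumes "open P" "smooth_on P f"
  shows "smooth_family A P (\<lambda>p _. f p)"
  unfolding smooth_family_def
proof
  fix c assume c: "c \<in> A"
  have "smooth_on (P \<times> chart_image c) (\<lambda>x. f (fst x + 0))"
    using assms c open_chart[OF c]
    by (intro smooth_on_compose_affine[where f = f and S = P])
       (auto simp: bounded_linear_fst intro: open_Times)
  then show "smooth_on (P \<times> chart_image c) (\<lambda>(p, z). f p)"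
    by (simp add: case_prod_beta')
qed

lemma smooth_family_add:
  assumes "open P" "smooth_family A P F" "smooth_family A P G"
  shows "smooth_family A P (\<lambda>p x. F p x + G p x)"
  unfolding smooth_family_def
proof
  fix c assume c: "c \<in> A"
  have "open (P \<times> chart_image c)" using assms open_chart[OF c] by (intro open_Times)
  from smooth_on_add[OF this smooth_familyD[OF assms(2) c] smooth_familyD[OF assms(3) c]]
  show "smooth_on (P \<times> chart_image c) (\<lambda>(p, z). F p (chart_inv c z) + G p (chart_inv c z))"
    by (simp add: case_prod_beta')
qed

lemma smooth_family_mult:
  assumes "open P" "smooth_family A P F" "smooth_family A P G"
  shows "smooth_family A P (\<lambda>p x. F p x * G p x)"
  unfolding smooth_family_def
proof
  fix c assume c: "c \<in> A"
  have "open (P \<times> chart_image c)" using assms open_chart[OF c] by (intro open_Times)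
  from smooth_on_mult[OF this smooth_familyD[OF assms(2) c] smooth_familyD[OF assms(3) c]]
  show "smooth_on (P \<times> chart_image c) (\<lambda>(p, z). F p (chart_inv c z) * G p (chart_inv c z))"
    by (simp add: case_prod_beta')
qed

lemma smooth_family_affine:
  fixes L :: "'q::euclidean_space \<Rightarrow> 'p::euclidean_space"
  assumes "open Q" "bounded_linear L" "\<And>q. q \<in> Q \<Longrightarrow> L q + b \<in> P" "smooth_family A P F"
  shows "smooth_family A Q (\<lambda>q. F (L q + b))"
  unfolding smooth_family_def
proof
  fix c assume c: "c \<in> A"
  have "bounded_linear (\<lambda>x. (L (fst x), snd x :: complex^'n))"
    by (intro bounded_linear_Pair bounded_linear_snd bounded_linear_compose[OF assms(2)] bounded_linear_fst)
  then have "smooth_on (Q \<times> chart_image c)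
      (\<lambda>x. (\<lambda>(p, z). F p (chart_inv c z)) ((L (fst x), snd x) + (b, 0)))"
    using assms c open_chart[OF c]
    by (intro smooth_on_compose_affine[where S = "P \<times> chart_image c"] smooth_familyD)
       (auto intro: open_Times)
  then show "smooth_on (Q \<times> chart_image c) (\<lambda>(q, z). F (L q + b) (chart_inv c z))"
    by (simp add: case_prod_beta')
qed

lemma smooth_family_at:
  assumes "smooth_family A P F" "p \<in> P"
  shows "smooth_fun A (F p)"
  unfolding smooth_fun_def
proof
  fix c assume c: "c \<in> A"
  have "bounded_linear (\<lambda>z :: complex^'n. (0 :: 'b, z))"
    by (intro bounded_linear_Pair bounded_linear_zero bounded_linear_ident)
  then have "smooth_on (chart_image c) (\<lambda>z. (\<lambda>(p, z). F p (chart_inv c z)) ((0, z) + (p, 0)))"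
    using assms c open_chart[OF c]
    by (intro smooth_on_compose_affine[where S = "P \<times> chart_image c"] smooth_familyD) auto
  then show "smooth_on (chart_image c) (\<lambda>z. F p (chart_inv c z))" by simp
qed

lemma smooth_family_point:
  assumes "open P" "smooth_family A P F"
  shows "smooth_on P (\<lambda>p. F p x)"
proof -
  obtain c where c: "c \<in> A" "x \<in> fst c" by (rule chart_cover)
  have "bounded_linear (\<lambda>p :: 'b. (p, 0 :: complex^'n))"
    by (intro bounded_linear_Pair bounded_linear_zero bounded_linear_ident)
  then have "smooth_on P (\<lambda>q. (\<lambda>(p, z). F p (chart_inv c z)) ((q, 0) + (0, snd c x)))"
    using assms c chart_in_image
    by (intro smooth_on_compose_affine[where S = "P \<times> chart_image c"] smooth_familyD) auto
  then show ?thesis using c chart_inv_chart by simp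
qed

lemma smooth_family_directional_derivative:
  assumes "open P" "smooth_family A P F"
  shows "smooth_family A P (\<lambda>p x. frechet_derivative (\<lambda>q. F q x) (at p) u)"
  unfolding smooth_family_def
proof
  fix c assume c: "c \<in> A"
  then show "smooth_on (P \<times> chart_image c) (\<lambda>(p, z). frechet_derivative (\<lambda>q. F q (chart_inv c z)) (at p) u)"
    using assms open_chart[OF c] by (intro smooth_on_partial(2) open_Times smooth_familyD)
qed

text \<open>\<open>P \<times> M\<close> is covered by the open sets \<open>P \<times> U\<close> with \<open>U\<close> a chart domain, on which continuity can be read
off from the local representative.\<close>

lemma smooth_family_continuous:
  assumes "open P" "smooth_family A P F"
  shows "continuous_on (P \<times> UNIV) (\<lambda>(p, x). F p x)"
proof -
  have "continuous_on (P \<times> fst c) (\<lambda>(p, x). F p x)" if c: "c \<in> A" for c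
  proof -
    have "continuous_on (P \<times> fst c) (\<lambda>y. (\<lambda>(p, z). F p (chart_inv c z)) (fst y, snd c (snd y)))"
    proof (rule continuous_on_compose2[OF smooth_on_imp_continuous_on[OF smooth_familyD[OF assms(2) c]]])
      show "continuous_on (P \<times> fst c) (\<lambda>y. (fst y, snd c (snd y)))"
        by (intro continuous_on_Pair continuous_on_fst continuous_on_id
              continuous_on_compose2[OF chart_continuous[OF c]] continuous_on_snd) auto
    qed (use chart_in_image[OF c] in auto)
    then show ?thesis
      by (rule continuous_on_eq) (auto simp: chart_inv_chart[OF c])
  qed
  then have "continuous_on (\<Union>c\<in>A. P \<times> fst c) (\<lambda>(p, x). F p x)"
    using assms open_chart by (intro continuous_on_open_UN open_Times) auto
  moreover have "P \<times> UNIV = (\<Union>c\<in>A. P \<times> fst c)" using atlas by (auto simp: complex_atlas_def)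
  ultimately show ?thesis by simp
qed

text \<open>Reduces sums, products and continuity of smooth functions to the corresponding facts about families.\<close>

lemma smooth_fun_iff_family: "smooth_fun A F \<longleftrightarrow> smooth_family A (UNIV :: real set) (\<lambda>_. F)"
  using smooth_family_const[of UNIV F] smooth_family_at[of UNIV "\<lambda>_. F" 0] by auto

lemma smooth_fun_const: "smooth_fun A (\<lambda>_. k)"
  by (simp add: smooth_fun_def smooth_on_const)

lemma smooth_fun_add: "smooth_fun A F \<Longrightarrow> smooth_fun A G \<Longrightarrow> smooth_fun A (\<lambda>x. F x + G x)"
  unfolding smooth_fun_iff_family by (rule smooth_family_add) auto

lemma smooth_fun_mult: "smooth_fun A F \<Longrightarrow> smooth_fun A G \<Longrightarrow> smooth_fun A (\<lambda>x. F x * G x)"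
  unfolding smooth_fun_iff_family by (rule smooth_family_mult) auto

lemma smooth_fun_inverse:
  "smooth_fun A F \<Longrightarrow> (\<And>x. F x \<noteq> 0) \<Longrightarrow> smooth_fun A (\<lambda>x. inverse (F x))"
  using open_chart by (auto simp: smooth_fun_def intro!: smooth_on_inverse)

lemma smooth_fun_continuous:
  assumes "smooth_fun A F"
  shows "continuous_on UNIV F"
proof -
  have c: "continuous_on UNIV (\<lambda>(p :: real, x). F x)"
    using smooth_family_continuous[of "UNIV :: real set" "\<lambda>_. F"] assms
    by (simp add: smooth_fun_iff_family)
  have "continuous_on UNIV (\<lambda>x. (\<lambda>(p :: real, x). F x) (0, x))"
    by (rule continuous_on_compose2[OF c]) (simp_all add: continuous_on_Pair)
  then show ?thesis by simp
qed

end

section \<open>The integral as a strictly positive functional\<close>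

definition pointwise_deriv :: "(real \<Rightarrow> 'a \<Rightarrow> real) \<Rightarrow> real \<Rightarrow> 'a \<Rightarrow> real" where
  "pointwise_deriv G t x = deriv (\<lambda>t'. G t' x) t"

context compact_kaehler
begin

abbreviation volume_density :: "('a, 'n) chart \<Rightarrow> complex^'n \<Rightarrow> real" where
  "volume_density c z \<equiv> wedge_power CARD('n) (\<omega> c z) complex_frame"

lemma volume_density_pos:
  assumes "c \<in> A" "z \<in> chart_image c"
  shows "volume_density c z > 0"
proof (rule wedge_power_pos)
  have k: "kaehler_form A \<omega>" using kaehler by (simp add: compact_connected_kaehler_def)
  then show "bilinear (\<omega> c z)" "\<omega> c z v v = 0" for v
    using assms by (auto simp: kaehler_form_def smooth_two_form_def)
  show "\<omega> c z (\<i> *s v) (\<i> *s w) = \<omega> c z v w" for v w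
    using k assms by (auto simp: kaehler_form_def)
  show "v \<noteq> 0 \<Longrightarrow> \<omega> c z v (\<i> *s v) > 0" for v
    using k assms by (auto simp: kaehler_form_def)
qed

lemma volume_density_continuous:
  assumes "c \<in> A"
  shows "continuous_on (chart_image c) (volume_density c)"
proof -
  have "smooth_on (chart_image c) (\<lambda>z. \<omega> c z v w)" for v w
    using kaehler assms by (auto simp: compact_connected_kaehler_def kaehler_form_def smooth_two_form_def)
  note smooth_on_imp_continuous_on[OF this]
  then show ?thesis
    unfolding wedge_power_def
    by (intro continuous_on_divide continuous_on_sum continuous_on_mult continuous_on_prod continuous_on_const) auto
qed

lemma top_integral_partition:
  obtains C \<rho> where "partition_of_unity A C \<rho>"
    "\<forall>F. top_integral A \<omega> F = (\<Sum>c\<in>C. LINT z:chart_image c|lborel.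
        \<rho> c (chart_inv c z) * F (chart_inv c z) * volume_density c z)"
proof -
  define p where "p = (SOME (C, \<rho>). partition_of_unity A C \<rho>)"
  have "\<exists>p. case p of (C, \<rho>) \<Rightarrow> partition_of_unity A C \<rho>"
    using partition_of_unity_exists[OF compact_UNIV atlas] by auto
  then have "case p of (C, \<rho>) \<Rightarrow> partition_of_unity A C \<rho>"
    unfolding p_def by (rule someI_ex)
  moreover obtain C \<rho> where p: "p = (C, \<rho>)" by (cases p)
  ultimately have "partition_of_unity A C \<rho>" by simp
  moreover have "top_integral A \<omega> F = (\<Sum>c\<in>C. LINT z:chart_image c|lborel.
        \<rho> c (chart_inv c z) * F (chart_inv c z) * volume_density c z)" for F
    unfolding top_integral_def p_def[symmetric] p Let_def by simp
  ultimately show thesis by (intro that allI)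
qed

text \<open>The partition function is supported in a compact subset of the chart domain, so the
integrand vanishes off a compact set although the chart image and the density may be unbounded.\<close>

lemma
  assumes part: "partition_of_unity A C \<rho>" and c: "c \<in> C" and F: "continuous_on UNIV F"
  defines "f \<equiv> \<lambda>z. \<rho> c (chart_inv c z) * F (chart_inv c z) * volume_density c z"
  shows partition_integrand_continuous: "continuous_on (chart_image c) f"
    and partition_integrand_integrable: "set_integrable lborel (chart_image c) f"
proof -
  have cA: "c \<in> A" and \<rho>: "continuous_on UNIV (\<rho> c)" "closure {x. \<rho> c x \<noteq> 0} \<subseteq> fst c"
    using part c by (auto simp: partition_of_unity_def)
  show cont: "continuous_on (chart_image c) f"
    unfolding f_def
    by (intro continuous_on_mult volume_density_continuous cA
        continuous_on_compose2[OF \<rho>(1)] continuous_on_compose2[OF F] chart_inv_continuous) auto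
  define K where "K = snd c ` closure {x. \<rho> c x \<noteq> 0}"
  have "compact (closure {x. \<rho> c x \<noteq> 0})"
    using compact_Int_closed[OF compact_UNIV closed_closure] by simp
  then have "compact K"
    unfolding K_def using chart_continuous[OF cA] \<rho>(2) by (auto intro: compact_continuous_image continuous_on_subset)
  have K: "K \<subseteq> chart_image c" using \<rho>(2) by (auto simp: K_def chart_image_def)
  have zero: "f z = 0" if "z \<in> chart_image c" "z \<notin> K" for z
  proof -
    have "z = snd c (chart_inv c z)" using that cA by (simp add: chart_chart_inv)
    then have "chart_inv c z \<notin> closure {x. \<rho> c x \<noteq> 0}" using that unfolding K_def by blast
    then have "\<rho> c (chart_inv c z) = 0" using closure_subset[of "{x. \<rho> c x \<noteq> 0}"] by auto
    then show ?thesis by (simp add: f_def)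
  qed
  have "integrable lborel (\<lambda>z. indicator K z *\<^sub>R f z)"
    using \<open>compact K\<close> continuous_on_subset[OF cont K] by (rule borel_integrable_compact)
  also have "(\<lambda>z. indicator K z *\<^sub>R f z) = (\<lambda>z. indicator (chart_image c) z *\<^sub>R f z)"
    using zero K by (auto simp: fun_eq_iff indicator_def)
  finally show "set_integrable lborel (chart_image c) f" by (simp add: set_integrable_def)
qed

lemma top_integral_add:
  assumes "continuous_on UNIV F" "continuous_on UNIV G"
  shows "top_integral A \<omega> (\<lambda>x. F x + G x) = top_integral A \<omega> F + top_integral A \<omega> G"
proof -
  obtain C \<rho> where part: "partition_of_unity A C \<rho>" and I: "\<forall>F. top_integral A \<omega> F = (\<Sum>c\<in>C. LINT z:chart_image c|lborel.
        \<rho> c (chart_inv c z) * F (chart_inv c z) * volume_density c z)" by (rule top_integral_partition)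
  show ?thesis
    unfolding I[rule_format] sum.distrib[symmetric]
  proof (rule sum.cong[OF refl])
    fix c assume "c \<in> C"
    note int = partition_integrand_integrable[OF part this]
    show "(LINT z:chart_image c|lborel.
          \<rho> c (chart_inv c z) * (F (chart_inv c z) + G (chart_inv c z)) * volume_density c z) =
        (LINT z:chart_image c|lborel. \<rho> c (chart_inv c z) * F (chart_inv c z) * volume_density c z) +
        (LINT z:chart_image c|lborel. \<rho> c (chart_inv c z) * G (chart_inv c z) * volume_density c z)"
      unfolding set_integral_add(2)[OF int[OF assms(1)] int[OF assms(2)], symmetric]
      by (simp add: algebra_simps)
  qed
qed

lemma top_integral_cmult: "top_integral A \<omega> (\<lambda>x. k * F x) = k * top_integral A \<omega> F"
proof -
  obtain C \<rho> where "partition_of_unity A C \<rho>" and I: "\<forall>F. top_integral A \<omega> F = (\<Sum>c\<in>C. LINT z:chart_image c|lborel.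
        \<rho> c (chart_inv c z) * F (chart_inv c z) * volume_density c z)" by (rule top_integral_partition)
  show ?thesis
    unfolding I[rule_format] sum_distrib_left set_integral_mult_right[symmetric]
    by (simp add: mult_ac)
qed

lemma top_integral_diff:
  assumes "continuous_on UNIV F" "continuous_on UNIV G"
  shows "top_integral A \<omega> (\<lambda>x. F x - G x) = top_integral A \<omega> F - top_integral A \<omega> G"
  using top_integral_add[of F "\<lambda>x. - 1 * G x"] top_integral_cmult[of "- 1" G] assms
  by (simp add: continuous_on_minus)

lemma top_integral_nonneg:
  assumes "\<And>x. F x \<ge> 0"
  shows "top_integral A \<omega> F \<ge> 0"
proof -
  obtain C \<rho> where part: "partition_of_unity A C \<rho>" and I: "\<forall>F. top_integral A \<omega> F = (\<Sum>c\<in>C. LINT z:chart_image c|lborel.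
        \<rho> c (chart_inv c z) * F (chart_inv c z) * volume_density c z)" by (rule top_integral_partition)
  have CA: "c \<in> C \<Longrightarrow> c \<in> A" for c using part by (auto simp: partition_of_unity_def)
  have \<rho>: "c \<in> C \<Longrightarrow> \<rho> c x \<ge> 0" for c x using part by (auto simp: partition_of_unity_def)
  show ?thesis
    unfolding I[rule_format] set_lebesgue_integral_def
  proof (intro sum_nonneg Bochner_Integration.integral_nonneg)
    fix c z assume "c \<in> C"
    then show "0 \<le> indicator (chart_image c) z *\<^sub>R
        (\<rho> c (chart_inv c z) * F (chart_inv c z) * volume_density c z)"
      using \<rho>[of c "chart_inv c z"] assms[of "chart_inv c z"] volume_density_pos[OF CA, of c z]
      by (cases "z \<in> chart_image c") (simp_all add: less_imp_le)
  qed
qed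

lemma top_integral_mono:
  assumes "continuous_on UNIV F" "continuous_on UNIV G" "\<And>x. F x \<le> G x"
  shows "top_integral A \<omega> F \<le> top_integral A \<omega> G"
  using top_integral_nonneg[of "\<lambda>x. G x - F x"] top_integral_diff[OF assms(2,1)] assms(3) by simp

text \<open>Some partition function is positive at \<open>x0\<close>; in that chart the integrand is nonnegative
and, since the density is positive, bounded below by a positive constant on a small ball.\<close>

lemma top_integral_pos:
  assumes F: "continuous_on UNIV F" "\<And>x. F x \<ge> 0" "F x0 > 0"
  shows "top_integral A \<omega> F > 0"
proof -
  obtain C \<rho> where part: "partition_of_unity A C \<rho>" and I: "\<forall>F. top_integral A \<omega> F = (\<Sum>c\<in>C. LINT z:chart_image c|lborel.
        \<rho> c (chart_inv c z) * F (chart_inv c z) * volume_density c z)" by (rule top_integral_partition)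
  have CA: "c \<in> C \<Longrightarrow> c \<in> A" for c using part by (auto simp: partition_of_unity_def)
  have \<rho>: "c \<in> C \<Longrightarrow> \<rho> c x \<ge> 0" for c x using part by (auto simp: partition_of_unity_def)
  define f where "f c z = \<rho> c (chart_inv c z) * F (chart_inv c z) * volume_density c z" for c z
  have nonneg: "f c z \<ge> 0" if "c \<in> C" "z \<in> chart_image c" for c z
    unfolding f_def using \<rho>[OF that(1), of "chart_inv c z"] F(2)[of "chart_inv c z"]
      volume_density_pos[OF CA[OF that(1)] that(2)] by simp
  have "(\<Sum>c\<in>C. \<rho> c x0) \<noteq> 0" using part by (simp add: partition_of_unity_def)
  then obtain c where c: "c \<in> C" "\<rho> c x0 \<noteq> 0" by (rule sum.not_neutral_contains_not_neutral)
  have cA: "c \<in> A" using CA c by blast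
  have "closure {x. \<rho> c x \<noteq> 0} \<subseteq> fst c" using part c(1) by (simp add: partition_of_unity_def)
  then have x0: "x0 \<in> fst c"
    using c(2) closure_subset[of "{x. \<rho> c x \<noteq> 0}"] by auto
  define z0 where "z0 = snd c x0"
  have z0: "z0 \<in> chart_image c" "chart_inv c z0 = x0"
    using chart_in_image[OF cA x0] chart_inv_chart[OF cA x0] by (auto simp: z0_def)
  have pos: "f c z0 > 0"
    using c \<rho>[OF c(1), of x0] F(3) volume_density_pos[OF cA z0(1)] by (simp add: f_def z0)
  have cont: "continuous_on (chart_image c) (f c)"
    unfolding f_def by (rule partition_integrand_continuous[OF part c(1) F(1)])
  have int: "set_integrable lborel (chart_image c) (f c)"
    unfolding f_def by (rule partition_integrand_integrable[OF part c(1) F(1)])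
  have "isCont (f c) z0"
    using cont z0 open_chart[OF cA] by (simp add: continuous_on_eq_continuous_at)
  then have "\<forall>\<^sub>F z in at z0. f c z0 / 2 < f c z"
    using pos by (intro order_tendstoD) (auto simp: isCont_def)
  then obtain d1 where d1: "d1 > 0" "\<And>z. z \<noteq> z0 \<Longrightarrow> dist z z0 < d1 \<Longrightarrow> f c z0 / 2 < f c z"
    by (auto simp: eventually_at)
  obtain d2 where d2: "d2 > 0" "ball z0 d2 \<subseteq> chart_image c"
    using z0 open_chart[OF cA] openE by blast
  define B where "B = ball z0 (min d1 d2)"
  have B: "B \<subseteq> chart_image c" "\<And>z. z \<in> B \<Longrightarrow> f c z0 / 2 \<le> f c z"
  proof -
    show "B \<subseteq> chart_image c" using d2 by (auto simp: B_def)
    show "f c z0 / 2 \<le> f c z" if "z \<in> B" for z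
      using that d1(2)[of z] pos by (cases "z = z0") (auto simp: B_def dist_commute)
  qed
  have mB: "0 < measure lborel B"
    unfolding B_def using d1 d2 content_ball_pos[of "min d1 d2" z0] by simp
  have "integrable lborel (indicator B :: complex^'n \<Rightarrow> real)"
    unfolding B_def by (intro integrable_real_indicator) (simp_all add: emeasure_bounded_finite[unfolded infinity_ennreal_def])
  then have intB: "integrable lborel (\<lambda>z. f c z0 / 2 * indicator B z)" by simp
  have "0 < f c z0 / 2 * measure lborel B" using pos mB by simp
  also have "\<dots> = (\<integral>z. f c z0 / 2 * indicator B z \<partial>lborel)" by simp
  also have "\<dots> \<le> (LINT z:chart_image c|lborel. f c z)"
    unfolding set_lebesgue_integral_def
  proof (rule Bochner_Integration.integral_mono[OF intB int[unfolded set_integrable_def]])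
    fix z
    show "f c z0 / 2 * indicator B z \<le> indicator (chart_image c) z *\<^sub>R f c z"
      using B nonneg[OF c(1), of z] by (auto simp: indicator_def)
  qed
  also have "\<dots> \<le> (\<Sum>c\<in>C. LINT z:chart_image c|lborel. f c z)"
  proof (rule member_le_sum[OF c(1)])
    show "finite C" using part by (simp add: partition_of_unity_def)
    show "0 \<le> (LINT z:chart_image b|lborel. f b z)" if "b \<in> C - {c}" for b
      unfolding set_lebesgue_integral_def using nonneg[of b] that
      by (intro Bochner_Integration.integral_nonneg) (auto simp: indicator_def)
  qed
  finally show ?thesis unfolding I[rule_format] f_def .
qed

lemma top_integral_square_eq_0:
  assumes "continuous_on UNIV W" "top_integral A \<omega> (\<lambda>x. W x * W x) = 0"
  shows "W x = 0"
proof (rule ccontr)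
  assume "W x \<noteq> 0"
  then have "W x * W x > 0" by (simp add: zero_less_mult_iff linorder_neq_iff disj_commute)
  then show False
    using top_integral_pos[of "\<lambda>x. W x * W x" x] assms by (simp add: continuous_on_mult)
qed

lemma top_integral_1_pos: "top_integral A \<omega> (\<lambda>_. 1) > 0"
  by (rule top_integral_pos) auto

lemma top_integral_const: "top_integral A \<omega> (\<lambda>_. k) = k * top_integral A \<omega> (\<lambda>_. 1)"
  using top_integral_cmult[of k "\<lambda>_. 1"] by simp

lemma top_integral_bound:
  assumes "continuous_on UNIV F" "\<And>x. \<bar>F x\<bar> \<le> b"
  shows "\<bar>top_integral A \<omega> F\<bar> \<le> b * top_integral A \<omega> (\<lambda>_. 1)"
proof -
  have "F x \<le> b" "- b \<le> F x" for x using assms(2)[of x] by linarith+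
  then have "top_integral A \<omega> F \<le> top_integral A \<omega> (\<lambda>_. b)" "top_integral A \<omega> (\<lambda>_. - b) \<le> top_integral A \<omega> F"
    using assms(1) by (auto intro!: top_integral_mono)
  then show ?thesis unfolding top_integral_const[of b] top_integral_const[of "- b"] by linarith
qed

section \<open>Differentiation under the integral sign\<close>

lemma smooth_family_has_deriv:
  assumes "open J" "smooth_family A J G" "t \<in> J"
  shows "((\<lambda>t. G t x) has_real_derivative pointwise_deriv G t x) (at t)"
  unfolding pointwise_deriv_def
  by (rule smooth_on_has_deriv[OF smooth_family_point[OF assms(1,2)] assms(3)])

lemma smooth_family_pointwise_deriv:
  assumes "open J" "smooth_family A J G"
  shows "smooth_family A J (pointwise_deriv G)"
proof (rule smooth_family_cong[OF assms(1) smooth_family_directional_derivative[OF assms, of 1]])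
  fix t x assume "t \<in> J"
  have "((\<lambda>t. G t x) has_real_derivative frechet_derivative (\<lambda>t. G t x) (at t) 1) (at t)"
    by (rule has_real_derivative_at_frechet[OF smooth_on_has_derivative[OF smooth_family_point[OF assms] \<open>t \<in> J\<close>]])
  then show "frechet_derivative (\<lambda>t. G t x) (at t) 1 = pointwise_deriv G t x"
    using smooth_family_has_deriv[OF assms \<open>t \<in> J\<close>] by (rule DERIV_unique)
qed

text \<open>By the mean value theorem a difference quotient at \<open>x\<close> is a value of the derivative at a nearby
parameter. Compactness of the manifold makes the derivative continuous in the parameter uniformly in \<open>x\<close>, so
the quotients converge uniformly, and a positive functional respects uniform convergence.\<close>

lemma top_integral_has_deriv:
  assumes J: "open J" and G: "smooth_family A J G" and t: "t \<in> J"
  shows "((\<lambda>t. top_integral A \<omega> (G t)) has_real_derivative top_integral A \<omega> (pointwise_deriv G t)) (at t)"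
proof -
  define V where "V = top_integral A \<omega> (\<lambda>_. 1)"
  have V: "V > 0" using top_integral_1_pos by (simp add: V_def)
  note G' = smooth_family_pointwise_deriv[OF J G]
  have cont: "continuous_on UNIV (G s)" "continuous_on UNIV (pointwise_deriv G s)" if "s \<in> J" for s
    by (rule smooth_fun_continuous[OF smooth_family_at[OF G that]],
        rule smooth_fun_continuous[OF smooth_family_at[OF G' that]])
  have "\<exists>d>0. \<forall>s. s \<noteq> t \<and> dist s t < d \<longrightarrow>
      dist ((top_integral A \<omega> (G s) - top_integral A \<omega> (G t)) / (s - t)) (top_integral A \<omega> (pointwise_deriv G t)) < e"
    if epos: "e > 0" for e
  proof -
    define e' where "e' = e / (2 * V)"
    have e': "e' > 0" using epos V by (simp add: e'_def)
    obtain X where X: "t \<in> X" "open X"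
      "\<forall>s\<in>X \<inter> J. \<forall>x\<in>UNIV. dist ((\<lambda>(s, x). pointwise_deriv G s x) (s, x)) ((\<lambda>(s, x). pointwise_deriv G s x) (t, x)) \<le> e'"
      using continuous_on_prod_compactE[OF smooth_family_continuous[OF J G'] compact_UNIV t e'] .
    have "open (X \<inter> J)" "t \<in> X \<inter> J" using X J t by auto
    then obtain d where d: "d > 0" "ball t d \<subseteq> X \<inter> J" using openE by blast
    have close: "\<bar>pointwise_deriv G s x - pointwise_deriv G t x\<bar> \<le> e'" if "\<bar>s - t\<bar> < d" for s x
      using X(3) d(2) that by (auto simp: subset_eq dist_real_def abs_minus_commute)
    have inJ: "s \<in> J" if "\<bar>s - t\<bar> < d" for s
      using d(2) that by (auto simp: subset_eq dist_real_def abs_minus_commute)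
    have "dist ((top_integral A \<omega> (G s) - top_integral A \<omega> (G t)) / (s - t)) (top_integral A \<omega> (pointwise_deriv G t)) < e"
      if s: "s \<noteq> t" "dist s t < d" for s
    proof -
      have sd: "\<bar>s - t\<bar> < d" using s by (simp add: dist_real_def)
      have quot: "\<bar>1 / (s - t) * (G s x - G t x) - pointwise_deriv G t x\<bar> \<le> e'" for x
      proof -
        have "\<exists>r. \<bar>r - t\<bar> < d \<and> G s x - G t x = (s - t) * pointwise_deriv G r x"
        proof (cases "t < s")
          case True
          have "\<exists>r. r > t \<and> r < s \<and> G s x - G t x = (s - t) * pointwise_deriv G r x"
            using True inJ sd by (intro MVT2 smooth_family_has_deriv[OF J G]) auto
          then obtain r where "r > t" "r < s" "G s x - G t x = (s - t) * pointwise_deriv G r x" by blast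
          then show ?thesis using sd by (intro exI[of _ r]) auto
        next
          case False
          then have "s < t" using s by simp
          then have "\<exists>r. r > s \<and> r < t \<and> G t x - G s x = (t - s) * pointwise_deriv G r x"
            using inJ sd by (intro MVT2 smooth_family_has_deriv[OF J G]) auto
          then obtain r where "r > s" "r < t" "G t x - G s x = (t - s) * pointwise_deriv G r x" by blast
          then show ?thesis using sd by (intro exI[of _ r]) (auto simp: algebra_simps)
        qed
        then obtain r where "\<bar>r - t\<bar> < d" "G s x - G t x = (s - t) * pointwise_deriv G r x" by blast
        then show ?thesis using close[of r x] s(1) by simp
      qed
      have cs: "continuous_on UNIV (G s)" "continuous_on UNIV (G t)" "continuous_on UNIV (pointwise_deriv G t)"
        using cont inJ[OF sd] t by auto
      have "1 / (s - t) * (top_integral A \<omega> (G s) - top_integral A \<omega> (G t)) - top_integral A \<omega> (pointwise_deriv G t)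
          = top_integral A \<omega> (\<lambda>x. 1 / (s - t) * (G s x - G t x) - pointwise_deriv G t x)"
        using cs by (simp add: top_integral_diff top_integral_cmult continuous_on_mult continuous_on_diff
            del: times_divide_eq_left)
      also have "\<bar>\<dots>\<bar> \<le> e' * V"
        unfolding V_def using cs quot
        by (intro top_integral_bound continuous_on_diff continuous_on_mult continuous_on_const) auto
      also have "e' * V < e" using V epos by (simp add: e'_def)
      finally show ?thesis by (simp add: dist_real_def)
    qed
    then show ?thesis using d(1) by blast
  qed
  then show ?thesis
    unfolding has_field_derivative_iff Lim_at by (simp add: dist_commute)
qed

text \<open>The derivative of the integral is the integral of another smooth family, so the order of
differentiability can be raised by induction.\<close>

lemma top_integral_smooth:
  fixes J :: "real set"
  assumes J: "open J" and G: "smooth_family A J G"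
  shows "smooth_on J (\<lambda>t. top_integral A \<omega> (G t))"
  unfolding smooth_on_def
proof
  show "ck_on k J (\<lambda>t. top_integral A \<omega> (G t))" for k
    using G
  proof (induction k arbitrary: G)
    case 0
    then show ?case
      using top_integral_has_deriv[OF J 0]
      by (auto intro!: continuous_at_imp_continuous_on DERIV_isCont)
  next
    case (Suc k)
    have d: "((\<lambda>t. top_integral A \<omega> (G t)) has_derivative (*) (top_integral A \<omega> (pointwise_deriv G t))) (at t)"
      if "t \<in> J" for t
      using top_integral_has_deriv[OF J Suc.prems that] by (simp add: has_field_derivative_def)
    have "ck_on k J (\<lambda>t. frechet_derivative (\<lambda>t. top_integral A \<omega> (G t)) (at t) v)" for v
    proof (rule ck_on_cong[OF J])
      show "ck_on k J (\<lambda>t. top_integral A \<omega> (pointwise_deriv G t) * v)"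
        by (intro ck_on_mult[OF J] ck_on_const Suc.IH smooth_family_pointwise_deriv[OF J Suc.prems])
    qed (use d[THEN frechet_derivative_eqI] in simp)
    then show ?case using d by (auto simp: differentiable_def)
  qed
qed

lemma top_integral_pointwise_deriv_const:
  assumes "open J" "smooth_family A J G" "\<And>t. t \<in> J \<Longrightarrow> top_integral A \<omega> (G t) = k" "t \<in> J"
  shows "top_integral A \<omega> (pointwise_deriv G t) = 0"
proof -
  have "((\<lambda>_. k) has_real_derivative top_integral A \<omega> (pointwise_deriv G t)) (at t)"
    by (rule has_field_derivative_transform_within_open[OF top_integral_has_deriv[OF assms(1,2,4)] assms(1,4)])
       (rule assms(3))
  then show ?thesis by (rule DERIV_unique[OF _ DERIV_const])
qed

end

section \<open>Two-parameter families\<close>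

context compact_kaehler
begin

lemma
  assumes P: "open P" and F: "smooth_family A P (\<lambda>(s, t). F s t)"
  shows partial_s_has_deriv: "(s, t) \<in> P \<Longrightarrow> ((\<lambda>s. F s t x) has_real_derivative partial_s F s t x) (at s)"
    and partial_t_has_deriv: "(s, t) \<in> P \<Longrightarrow> ((\<lambda>t. F s t x) has_real_derivative partial_t F s t x) (at t)"
    and smooth_family_partial_s: "smooth_family A P (\<lambda>(s, t). partial_s F s t)"
    and smooth_family_partial_t: "smooth_family A P (\<lambda>(s, t). partial_t F s t)"
proof -
  define f where "f x q = (case q of (s, t) \<Rightarrow> F s t) x" for x q
  have d: "(f x has_derivative frechet_derivative (f x) (at (s, t))) (at (s, t))" if "(s, t) \<in> P" for x s t
    unfolding f_def by (rule smooth_on_has_derivative[OF smooth_family_point[OF P F] that])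
  have s: "((\<lambda>s. F s t x) has_real_derivative frechet_derivative (f x) (at (s, t)) (1, 0)) (at s)"
    if "(s, t) \<in> P" for s t x
  proof -
    have 1: "((\<lambda>q. (q, t)) has_derivative (\<lambda>u. (u, 0))) (at s)"
      by (intro has_derivative_Pair has_derivative_ident has_derivative_const)
    show ?thesis
      using has_real_derivative_at_frechet[OF has_derivative_compose[OF 1 d[OF that, of x]]] by (simp add: f_def)
  qed
  have t: "((\<lambda>t. F s t x) has_real_derivative frechet_derivative (f x) (at (s, t)) (0, 1)) (at t)"
    if "(s, t) \<in> P" for s t x
  proof -
    have 1: "((\<lambda>q. (s, q)) has_derivative (\<lambda>u. (0, u))) (at t)"
      by (intro has_derivative_Pair has_derivative_ident has_derivative_const)
    show ?thesis
      using has_real_derivative_at_frechet[OF has_derivative_compose[OF 1 d[OF that, of x]]] by (simp add: f_def)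
  qed
  have s': "partial_s F s t x = frechet_derivative (f x) (at (s, t)) (1, 0)" if "(s, t) \<in> P" for s t x
    unfolding partial_s_def by (rule DERIV_imp_deriv[OF s[OF that]])
  have t': "partial_t F s t x = frechet_derivative (f x) (at (s, t)) (0, 1)" if "(s, t) \<in> P" for s t x
    unfolding partial_t_def by (rule DERIV_imp_deriv[OF t[OF that]])
  show "((\<lambda>s. F s t x) has_real_derivative partial_s F s t x) (at s)" if "(s, t) \<in> P"
    unfolding s'[OF that] by (rule s[OF that])
  show "((\<lambda>t. F s t x) has_real_derivative partial_t F s t x) (at t)" if "(s, t) \<in> P"
    unfolding t'[OF that] by (rule t[OF that])
  show "smooth_family A P (\<lambda>(s, t). partial_s F s t)"
    by (rule smooth_family_cong[OF P smooth_family_directional_derivative[OF P F, of "(1, 0)"]])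
       (auto simp: s' f_def[abs_def])
  show "smooth_family A P (\<lambda>(s, t). partial_t F s t)"
    by (rule smooth_family_cong[OF P smooth_family_directional_derivative[OF P F, of "(0, 1)"]])
       (auto simp: t' f_def[abs_def])
qed

text \<open>Smooth two-parameter families on a rectangle whose members all have the same integral \<open>k\<close>. For
\<open>k = \<integral> \<omega>\<^sup>n\<close> this covers families in \<open>\<C>\<close>, for \<open>k = 0\<close> families of tangent vectors, and partial
differentiation leads from any \<open>k\<close> to \<open>0\<close>.\<close>

definition smooth_square :: "real set \<Rightarrow> real set \<Rightarrow> real \<Rightarrow> (real \<Rightarrow> real \<Rightarrow> 'a \<Rightarrow> real) \<Rightarrow> bool" where
  "smooth_square I J k H \<longleftrightarrow> open_interval I \<and> open_interval J \<and>
     smooth_family A (I \<times> J) (\<lambda>(s, t). H s t) \<and> (\<forall>s\<in>I. \<forall>t\<in>J. top_integral A \<omega> (H s t) = k)"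

lemma smooth_square_open:
  assumes "smooth_square I J k H"
  shows "open I" "open J" "open (I \<times> J)"
  using assms by (auto simp: smooth_square_def open_interval_def open_Times)

lemma smooth_square_slice:
  assumes H: "smooth_square I J k H"
  shows "t \<in> J \<Longrightarrow> smooth_family A I (\<lambda>s. H s t)" and "s \<in> I \<Longrightarrow> smooth_family A J (H s)"
proof -
  have f: "smooth_family A (I \<times> J) (\<lambda>(s, t). H s t)" using H by (simp add: smooth_square_def)
  have 1: "bounded_linear (\<lambda>s. (s, 0 :: real))" "bounded_linear (\<lambda>t. (0 :: real, t))"
    by (intro bounded_linear_Pair bounded_linear_ident bounded_linear_zero)+
  show "smooth_family A I (\<lambda>s. H s t)" if "t \<in> J"
    using smooth_family_affine[OF smooth_square_open(1)[OF H] 1(1), of "(0, t)", OF _ f] that by simp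
  show "smooth_family A J (H s)" if "s \<in> I"
    using smooth_family_affine[OF smooth_square_open(2)[OF H] 1(2), of "(s, 0)", OF _ f] that by simp
qed

lemma smooth_square_partial:
  assumes H: "smooth_square I J k H"
  shows "smooth_square I J 0 (partial_s H)" and "smooth_square I J 0 (partial_t H)"
proof -
  have f: "smooth_family A (I \<times> J) (\<lambda>(s, t). H s t)"
    and k: "\<And>s t. s \<in> I \<Longrightarrow> t \<in> J \<Longrightarrow> top_integral A \<omega> (H s t) = k"
    using H by (auto simp: smooth_square_def)
  have "top_integral A \<omega> (partial_s H s t) = 0" if "s \<in> I" "t \<in> J" for s t
  proof -
    have "partial_s H s t = pointwise_deriv (\<lambda>s. H s t) s"
      by (simp add: fun_eq_iff partial_s_def pointwise_deriv_def)
    then show ?thesis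
      using top_integral_pointwise_deriv_const[OF smooth_square_open(1)[OF H] smooth_square_slice(1)[OF H that(2)]] k that
      by simp
  qed
  moreover have "top_integral A \<omega> (partial_t H s t) = 0" if "s \<in> I" "t \<in> J" for s t
  proof -
    have "partial_t H s t = pointwise_deriv (H s) t"
      by (simp add: fun_eq_iff partial_t_def pointwise_deriv_def)
    then show ?thesis
      using top_integral_pointwise_deriv_const[OF smooth_square_open(2)[OF H] smooth_square_slice(2)[OF H that(1)]] k that
      by simp
  qed
  ultimately show "smooth_square I J 0 (partial_s H)" and "smooth_square I J 0 (partial_t H)"
    using H smooth_family_partial_s[OF smooth_square_open(3)[OF H] f]
      smooth_family_partial_t[OF smooth_square_open(3)[OF H] f]
    by (auto simp: smooth_square_def)
qed

lemma smooth_square_field: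
  assumes H: "smooth_square I J 0 H"
  shows "t \<in> J \<Longrightarrow> smooth_field A \<omega> I (\<lambda>s. H s t)" and "s \<in> I \<Longrightarrow> smooth_field A \<omega> J (H s)"
proof -
  have k: "\<And>s t. s \<in> I \<Longrightarrow> t \<in> J \<Longrightarrow> top_integral A \<omega> (H s t) = 0"
    using H by (auto simp: smooth_square_def)
  show "smooth_field A \<omega> I (\<lambda>s. H s t)" if "t \<in> J"
    using smooth_square_slice(1)[OF H that] k that
    by (auto simp: smooth_field_def tangent_vectors_def intro: smooth_family_at)
  show "smooth_field A \<omega> J (H s)" if "s \<in> I"
    using smooth_square_slice(2)[OF H that] k that
    by (auto simp: smooth_field_def tangent_vectors_def intro: smooth_family_at)
qed

lemma smooth_square_partials_commute:
  assumes H: "smooth_square I J k H" and st: "s \<in> I" "t \<in> J"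
  shows "partial_t (partial_s H) s t x = partial_s (partial_t H) s t x"
proof -
  note o = smooth_square_open(3)[OF H]
  note H1 = smooth_square_partial(1)[OF H] and H2 = smooth_square_partial(2)[OF H]
  note H12 = smooth_square_partial(2)[OF H1] and H21 = smooth_square_partial(1)[OF H2]
  have f: "smooth_family A (I \<times> J) (\<lambda>(s, t). K s t)" if "smooth_square I J k' K" for K k'
    using that by (simp add: smooth_square_def)
  have c: "continuous_on (I \<times> J) (\<lambda>(s, t). K s t x)" if "smooth_square I J k' K" for K k'
    using smooth_on_imp_continuous_on[OF smooth_family_point[OF o f[OF that], of x]]
    by (simp add: case_prod_beta')
  show ?thesis
    by (rule mixed_partials_eq[of I J s t "\<lambda>s t. H s t x" "\<lambda>s t. partial_s H s t x" "\<lambda>s t. partial_t H s t x"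
          "\<lambda>s t. partial_t (partial_s H) s t x" "\<lambda>s t. partial_s (partial_t H) s t x"])
       (use o st c[OF H12] c[OF H21] partial_s_has_deriv[OF o f[OF H]] partial_t_has_deriv[OF o f[OF H]]
          partial_t_has_deriv[OF o f[OF H1]] partial_s_has_deriv[OF o f[OF H2]] in auto)
qed

lemma two_parameter_square:
  "smooth_two_parameter A \<omega> I J F \<Longrightarrow> smooth_square I J (top_integral A \<omega> (\<lambda>_. 1)) F"
  by (auto simp: smooth_two_parameter_def smooth_square_def conformal_factors_def)

lemma two_parameter_curve:
  assumes "smooth_two_parameter A \<omega> I J F"
  shows "t \<in> J \<Longrightarrow> smooth_curve A \<omega> I (\<lambda>s. F s t)" and "s \<in> I \<Longrightarrow> smooth_curve A \<omega> J (F s)"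
  using assms smooth_square_slice[OF two_parameter_square[OF assms]]
  by (auto simp: smooth_curve_def smooth_two_parameter_def)

section \<open>The pointwise derivative is a Levi-Civita derivative\<close>

text \<open>The constant weight metric without its normalising factor \<open>1 / n!\<close>.\<close>

abbreviation ip :: "('a \<Rightarrow> real) \<Rightarrow> ('a \<Rightarrow> real) \<Rightarrow> real" where
  "ip G H \<equiv> top_integral A \<omega> (\<lambda>x. G x * H x)"

lemma curve_open: "smooth_curve A \<omega> I F \<Longrightarrow> open I"
  by (simp add: smooth_curve_def open_interval_def)

lemma smooth_field_family: "smooth_field A \<omega> I G \<Longrightarrow> smooth_family A I G"
  by (simp add: smooth_field_def)

lemma smooth_field_tangent: "smooth_field A \<omega> I G \<Longrightarrow> t \<in> I \<Longrightarrow> G t \<in> tangent_vectors A \<omega>"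
  by (simp add: smooth_field_def)

lemma tangent_continuous: "X \<in> tangent_vectors A \<omega> \<Longrightarrow> continuous_on UNIV X"
  by (simp add: tangent_vectors_def smooth_fun_continuous)

lemma smooth_field_pointwise_deriv:
  assumes "open I" "smooth_field A \<omega> I G"
  shows "smooth_field A \<omega> I (pointwise_deriv G)"
  unfolding smooth_field_def tangent_vectors_def
proof (intro conjI ballI CollectI)
  note G = smooth_field_family[OF assms(2)]
  show G': "smooth_family A I (pointwise_deriv G)"
    by (rule smooth_family_pointwise_deriv[OF assms(1) G])
  fix t assume t: "t \<in> I"
  show "smooth_fun A (pointwise_deriv G t)" by (rule smooth_family_at[OF G' t])
  show "top_integral A \<omega> (pointwise_deriv G t) = 0"
    using smooth_field_tangent[OF assms(2)]
    by (intro top_integral_pointwise_deriv_const[OF assms(1) G _ t]) (auto simp: tangent_vectors_def)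
qed

lemma ip_has_deriv:
  assumes "open I" "smooth_family A I G" "smooth_family A I H" "t \<in> I"
  shows "((\<lambda>t. ip (G t) (H t)) has_real_derivative
    ip (pointwise_deriv G t) (H t) + ip (G t) (pointwise_deriv H t)) (at t)"
proof -
  have c: "continuous_on UNIV (G t)" "continuous_on UNIV (H t)"
    "continuous_on UNIV (pointwise_deriv G t)" "continuous_on UNIV (pointwise_deriv H t)"
    using assms by (auto intro!: smooth_fun_continuous smooth_family_at[of I] smooth_family_pointwise_deriv)
  have "pointwise_deriv (\<lambda>t x. G t x * H t x) t x = pointwise_deriv G t x * H t x + G t x * pointwise_deriv H t x" for x
    unfolding pointwise_deriv_def[of "\<lambda>t x. G t x * H t x"]
    by (rule DERIV_imp_deriv, rule derivative_eq_intros, rule smooth_family_has_deriv[OF assms(1,2,4)],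
        rule smooth_family_has_deriv[OF assms(1,3,4)], simp)
  then have "pointwise_deriv (\<lambda>t x. G t x * H t x) t = (\<lambda>x. pointwise_deriv G t x * H t x + G t x * pointwise_deriv H t x)"
    by (rule ext)
  moreover have "((\<lambda>t. ip (G t) (H t)) has_real_derivative
      top_integral A \<omega> (pointwise_deriv (\<lambda>t x. G t x * H t x) t)) (at t)"
    by (rule top_integral_has_deriv[OF assms(1) smooth_family_mult[OF assms(1-3)] assms(4)])
  ultimately show ?thesis
    using c by (simp add: top_integral_add continuous_on_mult)
qed

text \<open>Compatibility is the product rule under the integral, because the metric does not depend on the base
point; absence of torsion is the symmetry of mixed partial derivatives.\<close>

lemma levi_civita_pointwise_deriv:
  "levi_civita A \<omega> (constant_weight_metric A \<omega>) (\<lambda>I F G. pointwise_deriv G)"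
  unfolding levi_civita_def
proof (intro conjI)
  show "covariant_derivative A \<omega> (\<lambda>I F G. pointwise_deriv G)"
    unfolding covariant_derivative_def
  proof (intro conjI allI impI ballI)
    fix I F G assume "smooth_curve A \<omega> I F \<and> smooth_field A \<omega> I G"
    then show "smooth_field A \<omega> I (pointwise_deriv G)"
      by (blast intro: smooth_field_pointwise_deriv curve_open)
  next
    fix I F F' G G' t
    assume a: "smooth_curve A \<omega> I F \<and> smooth_field A \<omega> I G \<and> (\<forall>t\<in>I. F' t = F t \<and> G' t = G t)" and t: "t \<in> I"
    then have "\<forall>\<^sub>F s in nhds t. s \<in> I" using curve_open eventually_nhds_in_open by metis
    then have "\<forall>\<^sub>F s in nhds t. G' s x = G s x" for x
      by (rule eventually_mono) (use a in simp)
    then show "pointwise_deriv G' t = pointwise_deriv G t"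
      unfolding pointwise_deriv_def by (intro ext deriv_cong_ev) auto
  next
    fix I F G H t x
    assume a: "smooth_curve A \<omega> I F \<and> smooth_field A \<omega> I G \<and> smooth_field A \<omega> I H" and t: "t \<in> I"
    then have "((\<lambda>t. G t x + H t x) has_real_derivative pointwise_deriv G t x + pointwise_deriv H t x) (at t)"
      using curve_open smooth_field_family by (intro DERIV_add smooth_family_has_deriv[of I]) auto
    then show "pointwise_deriv (\<lambda>t x. G t x + H t x) t x = pointwise_deriv G t x + pointwise_deriv H t x"
      unfolding pointwise_deriv_def[of "\<lambda>t x. G t x + H t x"] by (rule DERIV_imp_deriv)
  next
    fix I F G and f :: "real \<Rightarrow> real" and t x
    assume a: "smooth_curve A \<omega> I F \<and> smooth_field A \<omega> I G \<and> smooth_on I f" and t: "t \<in> I"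
    have "((\<lambda>t. f t * G t x) has_real_derivative deriv f t * G t x + pointwise_deriv G t x * f t) (at t)"
      using a t curve_open smooth_field_family
      by (intro DERIV_mult smooth_family_has_deriv[of I] smooth_on_has_deriv[of I]) auto
    then show "pointwise_deriv (\<lambda>t x. f t * G t x) t x = deriv f t * G t x + f t * pointwise_deriv G t x"
      unfolding pointwise_deriv_def[of "\<lambda>t x. f t * G t x"] by (simp add: DERIV_imp_deriv mult.commute)
  qed
  show "metric_compatible A \<omega> (constant_weight_metric A \<omega>) (\<lambda>I F G. pointwise_deriv G)"
    unfolding metric_compatible_def constant_weight_metric_def
  proof (intro allI impI ballI)
    fix I F G H t
    assume a: "smooth_curve A \<omega> I F \<and> smooth_field A \<omega> I G \<and> smooth_field A \<omega> I H" and t: "t \<in> I"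
    have "((\<lambda>t. ip (G t) (H t) / fact CARD('n)) has_real_derivative
       (ip (pointwise_deriv G t) (H t) + ip (G t) (pointwise_deriv H t)) / fact CARD('n)) (at t)"
      using a t curve_open smooth_field_family by (intro DERIV_cdivide ip_has_deriv[of I]) auto
    then show "((\<lambda>t. ip (G t) (H t) / fact CARD('n)) has_real_derivative
       ip (pointwise_deriv G t) (H t) / fact CARD('n) + ip (G t) (pointwise_deriv H t) / fact CARD('n)) (at t)"
      by (simp add: add_divide_distrib)
  qed
  show "torsion_free A \<omega> (\<lambda>I F G. pointwise_deriv G)"
    unfolding torsion_free_def
  proof (intro allI impI ballI ext)
    fix I J F s t x
    assume F: "smooth_two_parameter A \<omega> I J F" and st: "s \<in> I" "t \<in> J"
    show "cov_t (\<lambda>I F G. pointwise_deriv G) J F (partial_s F) s t x =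
        cov_s (\<lambda>I F G. pointwise_deriv G) I F (partial_t F) s t x"
      using smooth_square_partials_commute[OF two_parameter_square[OF F] st, of x]
      by (simp add: cov_s_def cov_t_def pointwise_deriv_def partial_s_def partial_t_def)
  qed
qed

lemma tangent_diff:
  assumes "X \<in> tangent_vectors A \<omega>" "Y \<in> tangent_vectors A \<omega>"
  shows "(\<lambda>x. X x - Y x) \<in> tangent_vectors A \<omega>"
proof -
  have "smooth_fun A (\<lambda>x. X x + (- 1) * Y x)"
    using assms by (intro smooth_fun_add smooth_fun_mult smooth_fun_const) (auto simp: tangent_vectors_def)
  then show ?thesis
    using assms tangent_continuous[OF assms(1)] tangent_continuous[OF assms(2)]
    by (simp add: tangent_vectors_def top_integral_diff)
qed

lemma ip_diff_left:
  assumes "continuous_on UNIV X" "continuous_on UNIV Y" "continuous_on UNIV Z"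
  shows "ip (\<lambda>x. X x - Y x) Z = ip X Z - ip Y Z"
  using top_integral_diff[of "\<lambda>x. X x * Z x" "\<lambda>x. Y x * Z x"] assms
  by (simp add: continuous_on_mult left_diff_distrib)

lemma ip_commute: "ip X Y = ip Y X"
  by (simp add: mult.commute)

text \<open>The metric is nondegenerate: test \<open>W\<close> against itself.\<close>

lemma tangent_eq_0I:
  assumes "W \<in> tangent_vectors A \<omega>" "\<And>X. X \<in> tangent_vectors A \<omega> \<Longrightarrow> ip W X = 0"
  shows "W x = 0"
  using top_integral_square_eq_0[OF tangent_continuous[OF assms(1)]] assms by blast

lemma smooth_field_const:
  "open I \<Longrightarrow> X \<in> tangent_vectors A \<omega> \<Longrightarrow> smooth_field A \<omega> I (\<lambda>_. X)"
  by (simp add: smooth_field_def tangent_vectors_def smooth_family_const)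

lemma curve_velocity_tangent:
  assumes "smooth_curve A \<omega> I F" "t \<in> I"
  shows "pointwise_deriv F t \<in> tangent_vectors A \<omega>"
proof -
  have F: "open I" "smooth_family A I F" using assms by (auto simp: smooth_curve_def open_interval_def)
  have "top_integral A \<omega> (F t) = top_integral A \<omega> (\<lambda>_. 1)" if "t \<in> I" for t
    using assms that by (auto simp: smooth_curve_def conformal_factors_def)
  then show ?thesis
    using top_integral_pointwise_deriv_const[OF F _ assms(2)]
      smooth_family_at[OF smooth_family_pointwise_deriv[OF F] assms(2)]
    by (simp add: tangent_vectors_def)
qed

end

section \<open>Variations of a curve\<close>

context compact_kaehler
begin

text \<open>A variation of the given curve in a prescribed direction at a prescribed time: at a time \<open>t\<close> with
\<open>ip (F t) Y = 0\<close> its variation field is \<open>F t * Y\<close>. The variation must exist for all \<open>t \<in> I\<close> with a common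
range of \<open>s\<close>, although \<open>F t\<close> need not stay away from \<open>0\<close> as \<open>t\<close> approaches the ends of \<open>I\<close>. This is why it is
multiplicative: the factor \<open>1 + s (Y - m t)\<close> is positive for small \<open>s\<close>, independently of \<open>t\<close>. Subtracting the
mean \<open>m t\<close> of \<open>Y\<close> with weight \<open>F t\<close> keeps the total integral fixed, and this mean is bounded by the bound
of \<open>Y\<close>.\<close>

lemma smooth_two_parameter_curve_variation:
  assumes F: "smooth_curve A \<omega> I F" and Y: "smooth_fun A Y" "\<And>x. \<bar>Y x\<bar> \<le> b" and b: "b > 0"
  defines "m \<equiv> \<lambda>t. ip (F t) Y / top_integral A \<omega> (\<lambda>_. 1)"
  defines "J \<equiv> {- (1 / (2 * b)) <..< 1 / (2 * b)}"
  shows "smooth_two_parameter A \<omega> J I (\<lambda>s t x. F t x * (1 + s * (Y x - m t)))"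
proof -
  define V where "V = top_integral A \<omega> (\<lambda>_. 1)"
  have V: "V > 0" using top_integral_1_pos by (simp add: V_def)
  have I: "open I" "open_interval I" "smooth_family A I F"
    and Fc: "\<And>t. t \<in> I \<Longrightarrow> F t \<in> conformal_factors A \<omega>"
    using F by (auto simp: smooth_curve_def open_interval_def)
  have Fpos: "F t x > 0" and Fmass: "top_integral A \<omega> (F t) = V" and Fsm: "smooth_fun A (F t)"
    if "t \<in> I" for t x
    using Fc[OF that] by (auto simp: conformal_factors_def V_def)
  have J: "open J" "open_interval J" by (auto simp: J_def open_interval_def is_interval_oo)
  have o: "open (J \<times> I)" using I J by (intro open_Times)
  have "smooth_on I m"
    unfolding m_def divide_inverse using I Y
    by (intro smooth_on_mult smooth_on_const top_integral_smooth smooth_family_mult smooth_family_const)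
  then have "smooth_on (J \<times> I) (\<lambda>p. m (snd p + 0))"
    using o by (intro smooth_on_compose_affine bounded_linear_snd) auto
  then have sm: "smooth_family A (J \<times> I) (\<lambda>p _. m (snd p))"
    using smooth_family_scalar[OF o] by simp
  have sF: "smooth_family A (J \<times> I) (\<lambda>p. F (snd p))"
    using smooth_family_affine[OF o bounded_linear_snd, of 0, OF _ I(3)] by auto
  have ss: "smooth_family A (J \<times> I) (\<lambda>p _. fst p)"
    by (intro smooth_family_scalar[OF o] smooth_on_bounded_linear bounded_linear_fst)
  have "smooth_family A (J \<times> I) (\<lambda>p x. F (snd p) x * (1 + fst p * (Y x + (- 1) * m (snd p))))"
    by (intro smooth_family_mult[OF o] smooth_family_add[OF o] sF sm ss
        smooth_family_const[OF o] smooth_fun_const Y)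
  then have fam: "smooth_family A (J \<times> I) (\<lambda>(s, t) x. F t x * (1 + s * (Y x - m t)))"
    by (simp add: case_prod_beta')
  have "(\<lambda>x. F t x * (1 + s * (Y x - m t))) \<in> conformal_factors A \<omega>" if st: "s \<in> J" "t \<in> I" for s t
  proof -
    have c: "continuous_on UNIV (F t)" "continuous_on UNIV Y"
      using Fsm[OF st(2)] Y by (auto intro: smooth_fun_continuous)
    have mV: "m t * V = ip (F t) Y" using V by (simp add: m_def V_def)
    have "\<bar>ip (F t) Y\<bar> \<le> b * V"
    proof -
      have "F t x * Y x \<le> b * F t x" "(- b) * F t x \<le> F t x * Y x" for x
        using Y(2)[of x] Fpos[OF st(2), of x] mult_right_mono[of "Y x" b "F t x"] mult_right_mono[of "- b" "Y x" "F t x"]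
        by (auto simp: mult.commute abs_le_iff)
      then have "ip (F t) Y \<le> top_integral A \<omega> (\<lambda>x. b * F t x)" "top_integral A \<omega> (\<lambda>x. (- b) * F t x) \<le> ip (F t) Y"
        using c by (auto intro!: top_integral_mono continuous_on_mult continuous_on_minus)
      then show ?thesis
        unfolding top_integral_cmult Fmass[OF st(2)] by (simp add: abs_le_iff)
    qed
    then have "\<bar>m t\<bar> * V \<le> b * V" using mV V by (metis abs_mult abs_of_pos)
    then have "\<bar>m t\<bar> \<le> b" using V by simp
    then have "\<bar>Y x - m t\<bar> \<le> 2 * b" for x using Y(2)[of x] by linarith
    then have "\<bar>s * (Y x - m t)\<bar> \<le> \<bar>s\<bar> * (2 * b)" for x
      by (simp add: abs_mult mult_left_mono)
    moreover have "\<bar>s\<bar> * (2 * b) < 1"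
      using st(1) b by (auto simp: J_def abs_if field_simps)
    ultimately have "1 + s * (Y x - m t) > 0" for x by (smt (verit))
    then have pos: "F t x * (1 + s * (Y x - m t)) > 0" for x using Fpos[OF st(2)] by simp
    have "top_integral A \<omega> (\<lambda>x. F t x * (1 + s * (Y x - m t)))
        = top_integral A \<omega> (\<lambda>x. F t x + s * (F t x * Y x - m t * F t x))"
      by (simp add: algebra_simps)
    also have "\<dots> = V + s * (ip (F t) Y - m t * V)"
      using c by (simp add: top_integral_add top_integral_cmult top_integral_diff continuous_on_mult
          continuous_on_diff Fmass[OF st(2)])
    finally have "top_integral A \<omega> (\<lambda>x. F t x * (1 + s * (Y x - m t))) = V" using mV by simp
    moreover have "smooth_fun A (\<lambda>x. F t x * (1 + s * (Y x - m t)))"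
      using smooth_family_at[OF fam, of "(s, t)"] st by simp
    ultimately show ?thesis using pos by (simp add: conformal_factors_def V_def)
  qed
  then show ?thesis
    using I J fam by (simp add: smooth_two_parameter_def)
qed

text \<open>A piece of the affine plane through \<open>F0\<close> in the directions \<open>F0 * Y\<close> and \<open>F0 * Z\<close>.\<close>

lemma smooth_two_parameter_plane:
  assumes F0: "F0 \<in> conformal_factors A \<omega>" and Y: "smooth_fun A Y" "\<And>x. \<bar>Y x\<bar> \<le> b" "ip F0 Y = 0"
    and Z: "smooth_fun A Z" "\<And>x. \<bar>Z x\<bar> \<le> b" "ip F0 Z = 0" and b: "b > 0"
  defines "J \<equiv> {- (1 / (2 * b)) <..< 1 / (2 * b)}"
  shows "smooth_two_parameter A \<omega> J J (\<lambda>s t x. F0 x * (1 + s * Y x + t * Z x))"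
proof -
  have F0': "\<And>x. F0 x > 0" "smooth_fun A F0" "top_integral A \<omega> F0 = top_integral A \<omega> (\<lambda>_. 1)"
    using F0 by (auto simp: conformal_factors_def)
  have J: "open J" "open_interval J" by (auto simp: J_def open_interval_def is_interval_oo)
  have o: "open (J \<times> J)" using J by (intro open_Times)
  have "smooth_family A (J \<times> J) (\<lambda>p x. F0 x * (1 + fst p * Y x + snd p * Z x))"
    by (intro smooth_family_mult[OF o] smooth_family_add[OF o] smooth_family_scalar[OF o]
        smooth_on_bounded_linear bounded_linear_fst bounded_linear_snd
        smooth_family_const[OF o] smooth_fun_const F0' Y Z)
  then have fam: "smooth_family A (J \<times> J) (\<lambda>(s, t) x. F0 x * (1 + s * Y x + t * Z x))"
    by (simp add: case_prod_beta')
  have "(\<lambda>x. F0 x * (1 + s * Y x + t * Z x)) \<in> conformal_factors A \<omega>" if st: "s \<in> J" "t \<in> J" for s t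
  proof -
    have c: "continuous_on UNIV F0" "continuous_on UNIV Y" "continuous_on UNIV Z"
      using F0' Y Z by (auto intro: smooth_fun_continuous)
    have 1: "\<bar>s\<bar> * b < 1 / 2" "\<bar>t\<bar> * b < 1 / 2"
      using st b by (auto simp: J_def abs_if field_simps)
    have 2: "\<bar>s * Y x\<bar> \<le> \<bar>s\<bar> * b" "\<bar>t * Z x\<bar> \<le> \<bar>t\<bar> * b" for x
      using Y(2)[of x] Z(2)[of x] by (simp_all add: abs_mult mult_left_mono)
    have "1 + s * Y x + t * Z x > 0" for x
      using 1 2[of x] unfolding abs_le_iff by linarith
    then have pos: "F0 x * (1 + s * Y x + t * Z x) > 0" for x using F0' by simp
    have "top_integral A \<omega> (\<lambda>x. F0 x * (1 + s * Y x + t * Z x))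
        = top_integral A \<omega> (\<lambda>x. F0 x + (s * (F0 x * Y x) + t * (F0 x * Z x)))"
      by (simp add: algebra_simps)
    also have "\<dots> = top_integral A \<omega> F0"
      using c Y(3) Z(3) by (simp add: top_integral_add top_integral_cmult continuous_on_mult continuous_on_add)
    finally have "top_integral A \<omega> (\<lambda>x. F0 x * (1 + s * Y x + t * Z x)) = top_integral A \<omega> (\<lambda>_. 1)"
      using F0' by simp
    moreover have "smooth_fun A (\<lambda>x. F0 x * (1 + s * Y x + t * Z x))"
      using smooth_family_at[OF fam, of "(s, t)"] st by simp
    ultimately show ?thesis using pos by (simp add: conformal_factors_def)
  qed
  then show ?thesis using J fam by (simp add: smooth_two_parameter_def)
qed

end

section \<open>Uniqueness of the Levi-Civita derivative\<close>

locale kaehler_levi_civita = compact_kaehler A \<omega>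
  for A :: "('a::t2_space, 'n::finite) chart set" and \<omega> :: "('a, 'n) two_form" +
  fixes D :: "'a covariant_derivative"
  assumes lc: "levi_civita A \<omega> (constant_weight_metric A \<omega>) D"
begin

lemma D_field: "smooth_curve A \<omega> I F \<Longrightarrow> smooth_field A \<omega> I G \<Longrightarrow> smooth_field A \<omega> I (D I F G)"
  using lc by (simp add: levi_civita_def covariant_derivative_def)

lemma D_local:
  assumes "smooth_curve A \<omega> I F" "smooth_field A \<omega> I G" "\<And>t. t \<in> I \<Longrightarrow> G' t = G t" "t \<in> I"
  shows "D I F G' t = D I F G t"
proof -
  have "\<forall>I F F' G G'. smooth_curve A \<omega> I F \<and> smooth_field A \<omega> I G \<and>
      (\<forall>t\<in>I. F' t = F t \<and> G' t = G t) \<longrightarrow> (\<forall>t\<in>I. D I F' G' t = D I F G t)"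
    using lc unfolding levi_civita_def covariant_derivative_def by (elim conjE)
  from this[rule_format, of I F G F G' t] show ?thesis using assms by simp
qed

lemma D_compatible:
  assumes F: "smooth_curve A \<omega> I F" and G: "smooth_field A \<omega> I G" and H: "smooth_field A \<omega> I H" and t: "t \<in> I"
  shows "ip (D I F G t) (H t) + ip (G t) (D I F H t) = ip (pointwise_deriv G t) (H t) + ip (G t) (pointwise_deriv H t)"
proof -
  have "((\<lambda>t. ip (G t) (H t) / fact CARD('n)) has_real_derivative
       ip (D I F G t) (H t) / fact CARD('n) + ip (G t) (D I F H t) / fact CARD('n)) (at t)"
  proof -
    have "metric_compatible A \<omega> (constant_weight_metric A \<omega>) D" using lc by (simp add: levi_civita_def)
    from this[unfolded metric_compatible_def constant_weight_metric_def, rule_format, of I F G H t]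
    show ?thesis using F G H t by simp
  qed
  moreover have "((\<lambda>t. ip (G t) (H t) / fact CARD('n)) has_real_derivative
       (ip (pointwise_deriv G t) (H t) + ip (G t) (pointwise_deriv H t)) / fact CARD('n)) (at t)"
    using F G H t curve_open smooth_field_family by (intro DERIV_cdivide ip_has_deriv[of I]) auto
  ultimately have "(ip (D I F G t) (H t) + ip (G t) (D I F H t)) / fact CARD('n) =
      (ip (pointwise_deriv G t) (H t) + ip (G t) (pointwise_deriv H t)) / (fact CARD('n) :: real)"
    unfolding add_divide_distrib[of "ip (D I F G t) (H t)"] by (rule DERIV_unique)
  then show ?thesis by simp
qed

text \<open>The covariant derivative of a constant field. As all tangent spaces coincide, this measures the
deviation of \<open>D\<close> from the pointwise derivative, like the Christoffel symbols of an affine chart. It is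
not yet known to depend on the curve \<open>F\<close> only through its velocity at \<open>t\<close>, so the whole curve and its interval
are kept as arguments.\<close>

definition christoffel :: "real set \<Rightarrow> (real \<Rightarrow> 'a \<Rightarrow> real) \<Rightarrow> real \<Rightarrow> ('a \<Rightarrow> real) \<Rightarrow> 'a \<Rightarrow> real" where
  "christoffel I F t X = D I F (\<lambda>_. X) t"

lemma christoffel_tangent:
  assumes "smooth_curve A \<omega> I F" "t \<in> I" "X \<in> tangent_vectors A \<omega>"
  shows "christoffel I F t X \<in> tangent_vectors A \<omega>"
  unfolding christoffel_def
  by (intro smooth_field_tangent[OF D_field[OF assms(1) smooth_field_const] assms(2)] curve_open[OF assms(1)] assms(3))

lemma pointwise_deriv_constant: "pointwise_deriv (\<lambda>_. X) t = (\<lambda>_. 0)"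
  by (simp add: pointwise_deriv_def fun_eq_iff)

lemma top_integral_zero: "top_integral A \<omega> (\<lambda>_. 0) = 0"
  using top_integral_const[of 0] by simp

text \<open>Compatibility for constant fields, whose inner product is constant.\<close>

lemma christoffel_skew:
  assumes F: "smooth_curve A \<omega> I F" "t \<in> I" and X: "X \<in> tangent_vectors A \<omega>" "Y \<in> tangent_vectors A \<omega>"
  shows "ip (christoffel I F t X) Y = - ip X (christoffel I F t Y)"
proof -
  note c = smooth_field_const[OF curve_open[OF F(1)]]
  show ?thesis
    using D_compatible[OF F(1) c[OF X(1)] c[OF X(2)] F(2)]
    by (simp add: christoffel_def pointwise_deriv_constant top_integral_zero)
qed

text \<open>Pair the difference of the two sides with an arbitrary tangent vector, extended to a constant
field. Compatibility for \<open>G\<close> and this constant field, and skewness at the vector \<open>G t\<close>, show that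
the pairing vanishes.\<close>

lemma D_eq:
  assumes F: "smooth_curve A \<omega> I F" "t \<in> I" and G: "smooth_field A \<omega> I G"
  shows "D I F G t x = pointwise_deriv G t x + christoffel I F t (G t) x"
proof -
  note Gt = smooth_field_tangent[OF G F(2)]
  have DG: "D I F G t \<in> tangent_vectors A \<omega>"
    by (rule smooth_field_tangent[OF D_field[OF F(1) G] F(2)])
  have G': "pointwise_deriv G t \<in> tangent_vectors A \<omega>"
    by (rule smooth_field_tangent[OF smooth_field_pointwise_deriv[OF curve_open[OF F(1)] G] F(2)])
  have EG: "christoffel I F t (G t) \<in> tangent_vectors A \<omega>" by (rule christoffel_tangent[OF F Gt])
  define W where "W x = D I F G t x - pointwise_deriv G t x - christoffel I F t (G t) x" for x
  have "W \<in> tangent_vectors A \<omega>"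
    unfolding W_def[abs_def] by (intro tangent_diff DG G' EG)
  moreover have "ip W X = 0" if X: "X \<in> tangent_vectors A \<omega>" for X
  proof -
    have "ip W X = ip (D I F G t) X - ip (pointwise_deriv G t) X - ip (christoffel I F t (G t)) X"
      unfolding W_def
      using tangent_continuous[OF DG] tangent_continuous[OF G'] tangent_continuous[OF EG] tangent_continuous[OF X]
      by (simp add: ip_diff_left continuous_on_diff)
    moreover have "ip (D I F G t) X + ip (G t) (christoffel I F t X) = ip (pointwise_deriv G t) X"
      using D_compatible[OF F(1) G smooth_field_const[OF curve_open[OF F(1)] X] F(2)]
      by (simp add: christoffel_def pointwise_deriv_constant top_integral_zero)
    moreover have "ip (christoffel I F t (G t)) X = - ip (G t) (christoffel I F t X)" by (rule christoffel_skew[OF F Gt X])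
    ultimately show ?thesis by simp
  qed
  ultimately have "W x = 0" by (rule tangent_eq_0I)
  then show ?thesis by (simp add: W_def)
qed

text \<open>Expand both sides of the torsion identity by \<open>D_eq\<close>; the mixed partial derivatives cancel.\<close>

lemma christoffel_symmetric:
  assumes F: "smooth_two_parameter A \<omega> I J F" and st: "s \<in> I" "t \<in> J"
  shows "christoffel J (F s) t (partial_s F s t) = christoffel I (\<lambda>s. F s t) s (partial_t F s t)"
proof
  fix x
  note sq = two_parameter_square[OF F]
  have "D J (F s) (partial_s F s) t = D I (\<lambda>s. F s t) (\<lambda>s. partial_t F s t) s"
  proof -
    have "torsion_free A \<omega> D" using lc by (simp add: levi_civita_def)
    from this[unfolded torsion_free_def cov_s_def cov_t_def, rule_format, OF F st] show ?thesis .
  qed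
  moreover have "D J (F s) (partial_s F s) t x = partial_t (partial_s F) s t x + christoffel J (F s) t (partial_s F s t) x"
    using D_eq[OF two_parameter_curve(2)[OF F st(1)] st(2) smooth_square_field(2)[OF smooth_square_partial(1)[OF sq] st(1)]]
    by (simp add: partial_t_def pointwise_deriv_def)
  moreover have "D I (\<lambda>s. F s t) (\<lambda>s. partial_t F s t) s x =
      partial_s (partial_t F) s t x + christoffel I (\<lambda>s. F s t) s (partial_t F s t) x"
    using D_eq[OF two_parameter_curve(1)[OF F st(2)] st(1) smooth_square_field(1)[OF smooth_square_partial(2)[OF sq] st(2)]]
    by (simp add: partial_s_def pointwise_deriv_def)
  ultimately show "christoffel J (F s) t (partial_s F s t) x = christoffel I (\<lambda>s. F s t) s (partial_t F s t) x"
    using smooth_square_partials_commute[OF sq st, of x] by simp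
qed

text \<open>Symmetry for the variation of \<open>F\<close>: its coordinate curves through \<open>F t0\<close> are \<open>F\<close> itself and the segment in
direction \<open>F t0 * Y\<close>, the latter because \<open>m t0 = 0\<close>.\<close>

lemma christoffel_curve_variation:
  assumes F: "smooth_curve A \<omega> I F" "t0 \<in> I" and Y: "smooth_fun A Y" "\<And>x. \<bar>Y x\<bar> \<le> b" "ip (F t0) Y = 0"
    and b: "b > 0"
  shows "christoffel I F t0 (\<lambda>x. F t0 x * Y x) =
    christoffel {- (1 / (2 * b)) <..< 1 / (2 * b)} (\<lambda>s x. F t0 x * (1 + s * Y x)) 0 (pointwise_deriv F t0)"
proof -
  define J where "J = {- (1 / (2 * b)) <..< 1 / (2 * b)}"
  define m where "m t = ip (F t) Y / top_integral A \<omega> (\<lambda>_. 1)" for t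
  define \<Phi> where "\<Phi> s t x = F t x * (1 + s * (Y x - m t))" for s t x
  have "smooth_two_parameter A \<omega> J I \<Phi>"
    unfolding \<Phi>_def[abs_def] J_def m_def by (rule smooth_two_parameter_curve_variation[OF F(1) Y(1,2) b])
  moreover have "0 \<in> J" using b by (simp add: J_def)
  moreover have m0: "m t0 = 0" by (simp add: m_def Y(3))
  have "partial_s \<Phi> 0 t0 = (\<lambda>x. F t0 x * Y x)"
    unfolding partial_s_def \<Phi>_def m0
    by (intro ext DERIV_imp_deriv) (auto intro!: derivative_eq_intros)
  moreover have "\<Phi> 0 = F" by (simp add: \<Phi>_def fun_eq_iff)
  moreover have "partial_t \<Phi> 0 t0 = pointwise_deriv F t0"
    by (simp add: partial_t_def pointwise_deriv_def \<Phi>_def fun_eq_iff)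
  moreover have "(\<lambda>s. \<Phi> s t0) = (\<lambda>s x. F t0 x * (1 + s * Y x))" by (simp add: \<Phi>_def m0 fun_eq_iff)
  ultimately show ?thesis
    using christoffel_symmetric[of J I \<Phi> 0 t0] F(2) by (simp add: J_def)
qed

text \<open>Symmetry for the affine plane, whose coordinate curves through \<open>F0\<close> are two segments.\<close>

lemma christoffel_plane:
  assumes F0: "F0 \<in> conformal_factors A \<omega>" and Y: "smooth_fun A Y" "\<And>x. \<bar>Y x\<bar> \<le> b" "ip F0 Y = 0"
    and Z: "smooth_fun A Z" "\<And>x. \<bar>Z x\<bar> \<le> b" "ip F0 Z = 0" and b: "b > 0"
  defines "J \<equiv> {- (1 / (2 * b)) <..< 1 / (2 * b)}"
  shows "smooth_curve A \<omega> J (\<lambda>s x. F0 x * (1 + s * Y x))"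
    and "christoffel J (\<lambda>s x. F0 x * (1 + s * Z x)) 0 (\<lambda>x. F0 x * Y x) =
      christoffel J (\<lambda>s x. F0 x * (1 + s * Y x)) 0 (\<lambda>x. F0 x * Z x)"
proof -
  define \<Phi> where "\<Phi> s t x = F0 x * (1 + s * Y x + t * Z x)" for s t x
  have two: "smooth_two_parameter A \<omega> J J \<Phi>"
    unfolding \<Phi>_def[abs_def] J_def by (rule smooth_two_parameter_plane[OF F0 Y Z b])
  have J: "0 \<in> J" using b by (simp add: J_def)
  have s: "(\<lambda>s. \<Phi> s 0) = (\<lambda>s x. F0 x * (1 + s * Y x))" by (simp add: \<Phi>_def fun_eq_iff)
  have t: "\<Phi> 0 = (\<lambda>s x. F0 x * (1 + s * Z x))" by (simp add: \<Phi>_def fun_eq_iff)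
  show "smooth_curve A \<omega> J (\<lambda>s x. F0 x * (1 + s * Y x))"
    using two_parameter_curve(1)[OF two J] unfolding s .
  have "partial_s \<Phi> 0 0 = (\<lambda>x. F0 x * Y x)" "partial_t \<Phi> 0 0 = (\<lambda>x. F0 x * Z x)"
    unfolding partial_s_def partial_t_def \<Phi>_def
    by (intro ext DERIV_imp_deriv; auto intro!: derivative_eq_intros)+
  then show "christoffel J (\<lambda>s x. F0 x * (1 + s * Z x)) 0 (\<lambda>x. F0 x * Y x) =
      christoffel J (\<lambda>s x. F0 x * (1 + s * Y x)) 0 (\<lambda>x. F0 x * Z x)"
    using christoffel_symmetric[OF two J J] unfolding s t by simp
qed

text \<open>Write \<open>A\<^sub>F, A\<^sub>X, A\<^sub>Z\<close> for the operators of the curve \<open>F\<close> at \<open>t0\<close> and of the segments through \<open>F t0\<close> in the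
directions \<open>X\<close> and \<open>Z\<close>, and \<open>T\<close> for the velocity of \<open>F\<close>. The two preceding lemmas say
\<open>A\<^sub>F X = A\<^sub>X T\<close>, \<open>A\<^sub>F Z = A\<^sub>Z T\<close> and \<open>A\<^sub>X Z = A\<^sub>Z X\<close>. Alternating these with skewness turns \<open>\<langle>A\<^sub>F X, Z\<rangle>\<close> into
\<open>- \<langle>A\<^sub>F X, Z\<rangle>\<close>.\<close>

lemma christoffel_eq_0:
  assumes F: "smooth_curve A \<omega> I F" "t0 \<in> I" and X: "X \<in> tangent_vectors A \<omega>"
  shows "christoffel I F t0 X x = 0"
proof -
  have F0: "F t0 \<in> conformal_factors A \<omega>" using F by (simp add: smooth_curve_def)
  have pos: "F t0 x > 0" and F0s: "smooth_fun A (F t0)" for x using F0 by (auto simp: conformal_factors_def)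
  have "ip (christoffel I F t0 X) Z = 0" if Z: "Z \<in> tangent_vectors A \<omega>" for Z
  proof -
    \<comment> \<open>Tangent vectors are divided by \<open>F t0\<close> because the variations above are multiplicative.\<close>
    define q where "q U x = U x * inverse (F t0 x)" for U :: "'a \<Rightarrow> real" and x
    have Fq: "(\<lambda>x. F t0 x * q U x) = U" for U
      using pos by (simp add: q_def fun_eq_iff less_imp_neq[symmetric])
    have q: "smooth_fun A (q U)" "ip (F t0) (q U) = 0" if "U \<in> tangent_vectors A \<omega>" for U
    proof -
      show "smooth_fun A (q U)"
        unfolding q_def[abs_def] using that pos F0s
        by (intro smooth_fun_mult smooth_fun_inverse) (auto simp: tangent_vectors_def less_imp_neq[symmetric])
      show "ip (F t0) (q U) = 0" using that unfolding Fq by (simp add: tangent_vectors_def)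
    qed
    have "bounded (range (q U))" if "U \<in> tangent_vectors A \<omega>" for U
      using compact_continuous_image[OF smooth_fun_continuous[OF q(1)[OF that]] compact_UNIV]
      by (rule compact_imp_bounded)
    then obtain bX bZ where bXZ: "\<And>x. \<bar>q X x\<bar> \<le> bX" "\<And>x. \<bar>q Z x\<bar> \<le> bZ"
      using X Z unfolding bounded_iff by (auto simp: image_iff) metis
    define b where "b = max 1 (max bX bZ)"
    have b: "b > 0" and bX: "\<And>x. \<bar>q X x\<bar> \<le> b" and bZ: "\<And>x. \<bar>q Z x\<bar> \<le> b"
      using bXZ unfolding b_def by (auto intro: le_max_iff_disj[THEN iffD2])
    define J where "J = {- (1 / (2 * b)) <..< 1 / (2 * b)}"
    have J: "0 \<in> J" using b by (simp add: J_def)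
    define cX where "cX s x = F t0 x * (1 + s * q X x)" for s x
    define cZ where "cZ s x = F t0 x * (1 + s * q Z x)" for s x
    define T where "T = pointwise_deriv F t0"
    have T: "T \<in> tangent_vectors A \<omega>" unfolding T_def by (rule curve_velocity_tangent[OF F])
    have cX: "smooth_curve A \<omega> J cX" and cZ: "smooth_curve A \<omega> J cZ" and EXZ: "christoffel J cX 0 Z = christoffel J cZ 0 X"
      using christoffel_plane[OF F0 q(1)[OF X] bX q(2)[OF X] q(1)[OF Z] bZ q(2)[OF Z] b]
        christoffel_plane[OF F0 q(1)[OF Z] bZ q(2)[OF Z] q(1)[OF X] bX q(2)[OF X] b]
      unfolding Fq J_def[symmetric] cX_def[abs_def] cZ_def[abs_def] by auto
    have EX: "christoffel I F t0 X = christoffel J cX 0 T" and EZ: "christoffel I F t0 Z = christoffel J cZ 0 T"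
      using christoffel_curve_variation[OF F q(1)[OF X] bX q(2)[OF X] b] christoffel_curve_variation[OF F q(1)[OF Z] bZ q(2)[OF Z] b]
      unfolding Fq J_def[symmetric] cX_def[abs_def] cZ_def[abs_def] T_def by auto
    have "ip (christoffel I F t0 X) Z = ip (christoffel J cX 0 T) Z" by (simp only: EX)
    also have "\<dots> = - ip T (christoffel J cX 0 Z)" by (rule christoffel_skew[OF cX J T Z])
    also have "\<dots> = - ip T (christoffel J cZ 0 X)" by (simp only: EXZ)
    also have "\<dots> = ip (christoffel J cZ 0 T) X" using christoffel_skew[OF cZ J T X] by simp
    also have "\<dots> = ip (christoffel I F t0 Z) X" by (simp only: EZ)
    also have "\<dots> = - ip Z (christoffel I F t0 X)" by (rule christoffel_skew[OF F Z X])
    also have "\<dots> = - ip (christoffel I F t0 X) Z" by (simp only: ip_commute)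
    finally show ?thesis by simp
  qed
  then show ?thesis by (rule tangent_eq_0I[OF christoffel_tangent[OF F X]])
qed

lemma D_eq_pointwise_deriv:
  assumes "smooth_curve A \<omega> I F" "smooth_field A \<omega> I G" "t \<in> I"
  shows "D I F G t = pointwise_deriv G t"
  using D_eq[OF assms(1,3,2)] christoffel_eq_0[OF assms(1,3) smooth_field_tangent[OF assms(2,3)]]
  by (simp add: fun_eq_iff)

text \<open>The inner covariant derivatives agree with iterated partial derivatives on the parameter intervals only;
locality of \<open>D\<close> allows the outer derivatives to be computed from that.\<close>

lemma sectional_curvature_eq_0:
  assumes F: "smooth_two_parameter A \<omega> I J F" and st: "s \<in> I" "t \<in> J"
  shows "sectional_curvature (constant_weight_metric A \<omega>) D I J F s t = 0"
proof -
  note sq = two_parameter_square[OF F]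
  note cs = two_parameter_curve(1)[OF F] and ct = two_parameter_curve(2)[OF F]
  have cov_s: "cov_s D I F K s t = partial_s H s t"
    if H: "smooth_square I J 0 H" and st: "s \<in> I" "t \<in> J" and K: "\<And>s. s \<in> I \<Longrightarrow> K s t = H s t" for H K s t
  proof -
    note f = smooth_square_field(1)[OF H st(2)]
    have "cov_s D I F K s t = D I (\<lambda>s. F s t) (\<lambda>s. H s t) s"
      unfolding cov_s_def by (rule D_local[OF cs[OF st(2)] f _ st(1)]) (rule K)
    also have "\<dots> = partial_s H s t"
      unfolding D_eq_pointwise_deriv[OF cs[OF st(2)] f st(1)]
      by (simp add: partial_s_def pointwise_deriv_def fun_eq_iff)
    finally show ?thesis .
  qed
  have cov_t: "cov_t D J F K s t = partial_t H s t"
    if H: "smooth_square I J 0 H" and st: "s \<in> I" "t \<in> J" and K: "\<And>t. t \<in> J \<Longrightarrow> K s t = H s t" for H K s t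
  proof -
    note f = smooth_square_field(2)[OF H st(1)]
    have "cov_t D J F K s t = D J (F s) (H s) t"
      unfolding cov_t_def by (rule D_local[OF ct[OF st(1)] f _ st(2)]) (rule K)
    also have "\<dots> = partial_t H s t"
      unfolding D_eq_pointwise_deriv[OF ct[OF st(1)] f st(2)]
      by (simp add: partial_t_def pointwise_deriv_def fun_eq_iff)
    finally show ?thesis .
  qed
  note sq_t = smooth_square_partial(2)[OF sq]
  have "cov_s D I F (cov_t D J F (partial_t F)) s t = partial_s (partial_t (partial_t F)) s t"
    by (rule cov_s[OF smooth_square_partial(2)[OF sq_t] st]) (rule cov_t[OF sq_t _ st(2)], auto)
  moreover have "cov_t D J F (cov_s D I F (partial_t F)) s t = partial_t (partial_s (partial_t F)) s t"
    by (rule cov_t[OF smooth_square_partial(1)[OF sq_t] st]) (rule cov_s[OF sq_t st(1)], auto)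
  ultimately show ?thesis
    using smooth_square_partials_commute[OF sq_t st]
    by (simp add: sectional_curvature_def Let_def constant_weight_metric_def top_integral_zero)
qed

end

theorem corollary5p3:
  fixes A :: "('a::t2_space, 'n::finite) chart set" and \<omega> :: "('a, 'n) two_form"
  assumes "compact_connected_kaehler A \<omega>"
  shows "(\<exists>D. levi_civita A \<omega> (constant_weight_metric A \<omega>) D) \<and>
    (\<forall>D I J F s t.
       levi_civita A \<omega> (constant_weight_metric A \<omega>) D \<and>
       smooth_two_parameter A \<omega> I J F \<and> s \<in> I \<and> t \<in> J \<and>
       lin_indep_pair (partial_s F s t) (partial_t F s t) \<longrightarrow>
       sectional_curvature (constant_weight_metric A \<omega>) D I J F s t = 0)"
proof (intro conjI allI impI)
  have "compact_kaehler A \<omega>" using assms by (rule compact_kaehler.intro)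
  then show "\<exists>D. levi_civita A \<omega> (constant_weight_metric A \<omega>) D"
    by (intro exI) (rule compact_kaehler.levi_civita_pointwise_deriv)
  fix D I J F s t
  assume a: "levi_civita A \<omega> (constant_weight_metric A \<omega>) D \<and>
       smooth_two_parameter A \<omega> I J F \<and> s \<in> I \<and> t \<in> J \<and>
       lin_indep_pair (partial_s F s t) (partial_t F s t)"
  then have "kaehler_levi_civita A \<omega> D"
    using \<open>compact_kaehler A \<omega>\<close> by (simp add: kaehler_levi_civita_def kaehler_levi_civita_axioms_def)
  then show "sectional_curvature (constant_weight_metric A \<omega>) D I J F s t = 0"
    by (rule kaehler_levi_civita.sectional_curvature_eq_0) (use a in auto)
qed

end
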